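(* (Theorem of Lévy.) Let $X$ be a Banach space, let $(\Omega,\mathcal{A},P)$ be a probability space, and let $(M_t)_{t\ge0}$ be an ($L$-valued) set-valued process which is a martingale relative to a filtration $(\mathcal{F}_t)_{t\ge0}$, with $M_0=0$. Assume that $(M_t)_t$ has weakly continuous paths and that its quadratic variation satisfies $[M_t,M_t](T)=T$ for all $T\ge0$ (here $T$, as an element of $C(K)$, is the constant function $Te$). Then $(M_t)_t$ is a set-valued Brownian motion.
   Context: For a Banach space $X$, $ck(X)$ is the family of nonempty compact convex subsets of $X$, with Minkowski addition, multiplication by scalars and the Hausdorff metric $d_H$. $K$ is a compact Hausdorff space and $j:ck(X)\to C(K)$ is a map (such $K,j$ exist) satisfying: (a) $j(\alpha A+\beta C)=\alpha j(A)+\beta j(C)$ for all $A,C\in ck(X)$, $\alpha,\beta\ge 0$; (b) $d_H(A,C)=\|j(A)-j(C)\|_\infty$; (c) $j(ck(X))$ is norm closed in $C(K)$; (d) $j(\mathrm{co}(A\cup C))=\max\{j(A),j(C)\}$. Sums, differences and products are taken in $C(K)$ via $j$. $e$ is the unit function (constant $1$) of $C(K)$. $ck_r(X)$ denotes the collection of functions $r1_B$ with $r\in\mathbb{R}$, $B\in ck(X)$; $r1_B$ is identified with $r\,j(B)\in C(K)$. A set-valued process takes values in $ck_r(X)\subset C(K)$. $L$ denotes an $f$-algebra in $C(K)$ in which the process takes its values. An evaluation functional is an $f\in C(K)^*$ of the form $f(x)=x(k)$ for some fixed $k\in K$. For a Bochner integrable set-valued function $W$ and a sub-$\sigma$-algebra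 $\mathcal{F}\subset\mathcal{A}$, $\mathbb{E}(W\mid\mathcal{F})$ is a Bochner integrable function with respect to $(\Omega,\mathcal{F},P)$ such that $\mathbb{E}(f(W)\mid\mathcal{F})=f(\mathbb{E}(W\mid\mathcal{F}))$ for every $f\in C(K)^*$. A set-valued process $(M_t)_t$ is a martingale relative to $(\mathcal{F}_t)_t$ if each $M_t$ is Bochner integrable and $\mathbb{E}(M_t\mid\mathcal{F}_s)=M_s$ for all $s<t$. The quadratic variation $[M_t,M_t]$ of an $L$-valued adapted process, when it exists, is given by $$\lim_{\|\pi\|\to0}\Big\|f([M_t,M_t](T))-f\Big(\sum_{i=0}^{n-1}[M_{t_{i+1}}-M_{t_i}]^2\Big)\Big\|_2=0$$ for every evaluation functional $f\in C(K)^*$ and every $T>0$, where $\pi=\{0=t_0<t_1<\dots<t_n=T\}$ ranges over partitions of $[0,T]$, $\|\pi\|$ is the mesh and $\|\cdot\|_2$ is the norm of $L^2(\Omega,P)$. A process $(B_t)_t$ with values in $ck_r(X)\subset C(K)$ is a set-valued Brownian motion if: (1) there is an $f$-algebra $L$ such that $B_t(\omega)\in L$ for each $\omega\in\Omega$ and $t>0$; (2) $B_t$ and $B_t^2$ are $C(K)$-valued Bochner integrable functions for each $t>0$; (3) for every evaluation functional $f\in C(K)^*$ the process $(f(B_t))_t$ is a standard real Brownian motion. *)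

theory Defs
  imports "HOL-Probability.Probability"
begin

section \<open>The space of continuous functions on a compact Hausdorff space\<close>

text \<open>
  A compact Hausdorff space \<open>K\<close> is a type of class \<^class>\<open>t2_space\<close> with compact universe. On
  such a type every continuous real function is bounded, so \<open>'k \<Rightarrow>\<^sub>C real\<close> with its supremum norm
  is \<open>C(K)\<close>.
\<close>

definition CK_mult :: "('k::topological_space \<Rightarrow>\<^sub>C real) \<Rightarrow> ('k \<Rightarrow>\<^sub>C real) \<Rightarrow> ('k \<Rightarrow>\<^sub>C real)" where
  "CK_mult f g = Bcontfun (\<lambda>k. apply_bcontfun f k * apply_bcontfun g k)"

definition CK_sup :: "('k::topological_space \<Rightarrow>\<^sub>C real) \<Rightarrow> ('k \<Rightarrow>\<^sub>C real) \<Rightarrow> ('k \<Rightarrow>\<^sub>C real)" where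
  "CK_sup f g = Bcontfun (\<lambda>k. max (apply_bcontfun f k) (apply_bcontfun g k))"

definition CK_inf :: "('k::topological_space \<Rightarrow>\<^sub>C real) \<Rightarrow> ('k \<Rightarrow>\<^sub>C real) \<Rightarrow> ('k \<Rightarrow>\<^sub>C real)" where
  "CK_inf f g = Bcontfun (\<lambda>k. min (apply_bcontfun f k) (apply_bcontfun g k))"

lemma apply_CK_mult [simp]:
  "apply_bcontfun (CK_mult f g) k = apply_bcontfun f k * apply_bcontfun g k"
proof -
  have "(\<lambda>k. apply_bcontfun f k * apply_bcontfun g k) \<in> bcontfun"
  proof (rule bcontfun_normI)
    show "continuous_on UNIV (\<lambda>k. apply_bcontfun f k * apply_bcontfun g k)"
      by (intro continuous_intros) auto
    show "norm (apply_bcontfun f k * apply_bcontfun g k) \<le> norm f * norm g" for k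
      unfolding norm_mult by (intro mult_mono norm_bounded) auto
  qed
  then show ?thesis
    by (simp add: CK_mult_def Bcontfun_inverse)
qed

lemma apply_CK_sup [simp]:
  "apply_bcontfun (CK_sup f g) k = max (apply_bcontfun f k) (apply_bcontfun g k)"
proof -
  have "(\<lambda>k. max (apply_bcontfun f k) (apply_bcontfun g k)) \<in> bcontfun"
  proof (rule bcontfun_normI)
    show "continuous_on UNIV (\<lambda>k. max (apply_bcontfun f k) (apply_bcontfun g k))"
      by (intro continuous_intros) auto
    show "norm (max (apply_bcontfun f k) (apply_bcontfun g k)) \<le> max (norm f) (norm g)" for k
      using norm_bounded[of f k] norm_bounded[of g k] by (auto simp: max_def)
  qed
  then show ?thesis
    by (simp add: CK_sup_def Bcontfun_inverse)
qed

lemma apply_CK_inf [simp]: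
  "apply_bcontfun (CK_inf f g) k = min (apply_bcontfun f k) (apply_bcontfun g k)"
proof -
  have "(\<lambda>k. min (apply_bcontfun f k) (apply_bcontfun g k)) \<in> bcontfun"
  proof (rule bcontfun_normI)
    show "continuous_on UNIV (\<lambda>k. min (apply_bcontfun f k) (apply_bcontfun g k))"
      by (intro continuous_intros) auto
    show "norm (min (apply_bcontfun f k) (apply_bcontfun g k)) \<le> max (norm f) (norm g)" for k
      using norm_bounded[of f k] norm_bounded[of g k] by (auto simp: min_def)
  qed
  then show ?thesis
    by (simp add: CK_inf_def Bcontfun_inverse)
qed

definition CK_nonneg :: "('k::topological_space \<Rightarrow>\<^sub>C real) \<Rightarrow> bool" where
  "CK_nonneg x \<longleftrightarrow> (\<forall>k. 0 \<le> apply_bcontfun x k)"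

definition CK_unit :: "'k::topological_space \<Rightarrow>\<^sub>C real" where
  "CK_unit = const_bcontfun 1"

text \<open>
  The operations of an f-algebra in \<open>C(K)\<close> are those of \<open>C(K)\<close>, so it is a vector sublattice and
  subalgebra. The last two clauses are the f-algebra axioms; for the pointwise order and
  product they hold automatically.
\<close>

definition f_algebra :: "('k::topological_space \<Rightarrow>\<^sub>C real) set \<Rightarrow> bool" where
  "f_algebra L \<longleftrightarrow>
     subspace L \<and>
     (\<forall>x\<in>L. \<forall>y\<in>L. CK_sup x y \<in> L \<and> CK_inf x y \<in> L \<and> CK_mult x y \<in> L) \<and>
     (\<forall>x\<in>L. \<forall>y\<in>L. CK_nonneg x \<longrightarrow> CK_nonneg y \<longrightarrow> CK_nonneg (CK_mult x y)) \<and>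
     (\<forall>x\<in>L. \<forall>y\<in>L. \<forall>z\<in>L. CK_inf x y = 0 \<longrightarrow> CK_nonneg z \<longrightarrow>
        CK_inf (CK_mult x z) y = 0 \<and> CK_inf (CK_mult z x) y = 0)"

definition evaluation_functional :: "(('k::topological_space \<Rightarrow>\<^sub>C real) \<Rightarrow> real) \<Rightarrow> bool" where
  "evaluation_functional f \<longleftrightarrow> (\<exists>k. f = (\<lambda>x. apply_bcontfun x k))"

section \<open>Compact convex sets and their embedding\<close>

definition ck :: "'x::real_normed_vector set set" where
  "ck = {A. A \<noteq> {} \<and> compact A \<and> convex A}"

definition hausdorff_dist :: "'x::metric_space set \<Rightarrow> 'x set \<Rightarrow> real" where
  "hausdorff_dist A C = max (SUP a\<in>A. infdist a C) (SUP c\<in>C. infdist c A)"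

definition ck_embedding :: "('x::banach set \<Rightarrow> ('k::t2_space \<Rightarrow>\<^sub>C real)) \<Rightarrow> bool" where
  "ck_embedding j \<longleftrightarrow>
     (\<forall>A\<in>ck. \<forall>C\<in>ck. \<forall>\<alpha>\<ge>0. \<forall>\<beta>\<ge>0.
        j {\<alpha> *\<^sub>R a + \<beta> *\<^sub>R c | a c. a \<in> A \<and> c \<in> C} = \<alpha> *\<^sub>R j A + \<beta> *\<^sub>R j C) \<and>
     (\<forall>A\<in>ck. \<forall>C\<in>ck. hausdorff_dist A C = norm (j A - j C)) \<and>
     closed (j ` ck) \<and>
     (\<forall>A\<in>ck. \<forall>C\<in>ck. j (convex hull (A \<union> C)) = CK_sup (j A) (j C))"

text \<open>The functions \<open>r1\<^sub>B\<close>, already identified with their images \<open>r j(B)\<close> in \<open>C(K)\<close>.\<close>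

definition ck_r :: "('x::banach set \<Rightarrow> ('k::t2_space \<Rightarrow>\<^sub>C real)) \<Rightarrow> ('k \<Rightarrow>\<^sub>C real) set" where
  "ck_r j = {r *\<^sub>R j B | r B. B \<in> ck}"

section \<open>Bochner integrability, conditional expectation and martingales\<close>

text \<open>
  \<^const>\<open>integrable\<close> requires a second countable codomain, which \<open>C(K)\<close> need not be. This is its
  definition without that sort constraint: a Borel function that is an \<open>L\<^sup>1\<close>-limit of
  integrable simple functions (such a function is essentially separably valued). Convergence of
  the integrals is left out because it is automatic in a Banach space.
\<close>

definition bochner_integrable :: "'a measure \<Rightarrow> ('a \<Rightarrow> 'b::real_normed_vector) \<Rightarrow> bool" where
  "bochner_integrable M f \<longleftrightarrow>
     f \<in> borel_measurable M \<and>
     (\<exists>s. (\<forall>i. Bochner_Integration.simple_bochner_integrable M (s i)) \<and>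
          (\<lambda>i. \<integral>\<^sup>+ \<omega>. ennreal (norm (f \<omega> - s i \<omega>)) \<partial>M) \<longlonglongrightarrow> 0)"

text \<open>\<open>V\<close> is a version of the conditional expectation of \<open>W\<close> given \<open>F\<close>; in particular \<open>V\<close> is
  \<open>F\<close>-measurable.\<close>

definition bochner_cond_exp ::
    "'a measure \<Rightarrow> 'a measure \<Rightarrow> ('a \<Rightarrow> 'b::real_normed_vector) \<Rightarrow> ('a \<Rightarrow> 'b) \<Rightarrow> bool" where
  "bochner_cond_exp P F W V \<longleftrightarrow>
     bochner_integrable (restr_to_subalg P F) V \<and>
     (\<forall>f :: 'b \<Rightarrow> real. bounded_linear f \<longrightarrow>
        (AE \<omega> in P. real_cond_exp P F (\<lambda>\<omega>. f (W \<omega>)) \<omega> = f (V \<omega>)))"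

definition filtration_on :: "'a measure \<Rightarrow> (real \<Rightarrow> 'a measure) \<Rightarrow> bool" where
  "filtration_on P F \<longleftrightarrow>
     (\<forall>t\<ge>0. subalgebra P (F t)) \<and> (\<forall>s t. 0 \<le> s \<and> s \<le> t \<longrightarrow> sets (F s) \<subseteq> sets (F t))"

definition bochner_martingale ::
    "'a measure \<Rightarrow> (real \<Rightarrow> 'a measure) \<Rightarrow> (real \<Rightarrow> 'a \<Rightarrow> 'b::real_normed_vector) \<Rightarrow> bool" where
  "bochner_martingale P F M \<longleftrightarrow>
     (\<forall>t\<ge>0. bochner_integrable P (M t)) \<and>
     (\<forall>s t. 0 \<le> s \<and> s < t \<longrightarrow> bochner_cond_exp P (F s) (M t) (M s))"

definition weakly_continuous_paths ::
    "'a measure \<Rightarrow> (real \<Rightarrow> 'a \<Rightarrow> 'b::real_normed_vector) \<Rightarrow> bool" where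
  "weakly_continuous_paths P M \<longleftrightarrow>
     (AE \<omega> in P. \<forall>f :: 'b \<Rightarrow> real. bounded_linear f \<longrightarrow> continuous_on {0..} (\<lambda>t. f (M t \<omega>)))"

section \<open>Quadratic variation\<close>

text \<open>A partition \<open>0 = t\<^sub>0 < \<dots> < t\<^sub>n = T\<close> is the list of its points.\<close>

definition partitions :: "real \<Rightarrow> real list set" where
  "partitions T = {ts. ts \<noteq> [] \<and> sorted_wrt (<) ts \<and> hd ts = 0 \<and> last ts = T}"

definition mesh :: "real list \<Rightarrow> real" where
  "mesh ts = Max ((\<lambda>i. ts ! Suc i - ts ! i) ` {..<length ts - 1})"

definition mesh_to_0 :: "real \<Rightarrow> real list filter" where
  "mesh_to_0 T = inf (filtercomap mesh (at_right 0)) (principal (partitions T))"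

definition L2_norm :: "'a measure \<Rightarrow> ('a \<Rightarrow> real) \<Rightarrow> ennreal" where
  "L2_norm P g =
     (if g \<in> borel_measurable P \<and> integrable P (\<lambda>\<omega>. (g \<omega>)\<^sup>2)
      then ennreal (sqrt (\<integral>\<omega>. (g \<omega>)\<^sup>2 \<partial>P)) else \<infinity>)"

definition sum_of_squares ::
    "(real \<Rightarrow> 'a \<Rightarrow> ('k::topological_space \<Rightarrow>\<^sub>C real)) \<Rightarrow> real list \<Rightarrow> 'a \<Rightarrow> ('k \<Rightarrow>\<^sub>C real)" where
  "sum_of_squares M ts \<omega> =
     (\<Sum>i<length ts - 1. CK_mult (M (ts ! Suc i) \<omega> - M (ts ! i) \<omega>) (M (ts ! Suc i) \<omega> - M (ts ! i) \<omega>))"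

definition quadratic_variation ::
    "'a measure \<Rightarrow> (real \<Rightarrow> 'a \<Rightarrow> ('k::topological_space \<Rightarrow>\<^sub>C real)) \<Rightarrow>
     (real \<Rightarrow> 'a \<Rightarrow> ('k \<Rightarrow>\<^sub>C real)) \<Rightarrow> bool" where
  "quadratic_variation P M Q \<longleftrightarrow>
     (\<forall>f. evaluation_functional f \<longrightarrow> (\<forall>T>0.
        ((\<lambda>ts. L2_norm P (\<lambda>\<omega>. f (Q T \<omega>) - f (sum_of_squares M ts \<omega>))) \<longlongrightarrow> 0) (mesh_to_0 T)))"

section \<open>Brownian motion\<close>

definition standard_brownian_motion :: "'a measure \<Rightarrow> (real \<Rightarrow> 'a \<Rightarrow> real) \<Rightarrow> bool" where
  "standard_brownian_motion P W \<longleftrightarrow>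
     (\<forall>t\<ge>0. W t \<in> borel_measurable P) \<and>
     (AE \<omega> in P. W 0 \<omega> = 0) \<and>
     (\<forall>ts. sorted ts \<and> (\<forall>t\<in>set ts. 0 \<le> t) \<longrightarrow>
        prob_space.indep_vars P (\<lambda>_. borel) (\<lambda>i \<omega>. W (ts ! Suc i) \<omega> - W (ts ! i) \<omega>)
          {..<length ts - 1}) \<and>
     (\<forall>s t. 0 \<le> s \<and> s < t \<longrightarrow>
        distributed P lborel (\<lambda>\<omega>. W t \<omega> - W s \<omega>)
          (\<lambda>x. ennreal (normal_density 0 (sqrt (t - s)) x))) \<and>
     (AE \<omega> in P. continuous_on {0..} (\<lambda>t. W t \<omega>))"

definition set_valued_brownian_motion ::
    "('x::banach set \<Rightarrow> ('k::t2_space \<Rightarrow>\<^sub>C real)) \<Rightarrow> 'a measure \<Rightarrow>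
     (real \<Rightarrow> 'a \<Rightarrow> ('k \<Rightarrow>\<^sub>C real)) \<Rightarrow> bool" where
  "set_valued_brownian_motion j P B \<longleftrightarrow>
     (\<forall>t\<ge>0. \<forall>\<omega>\<in>space P. B t \<omega> \<in> ck_r j) \<and>
     (\<exists>L. f_algebra L \<and> (\<forall>\<omega>\<in>space P. \<forall>t>0. B t \<omega> \<in> L)) \<and>
     (\<forall>t>0. bochner_integrable P (B t) \<and>
            bochner_integrable P (\<lambda>\<omega>. CK_mult (B t \<omega>) (B t \<omega>))) \<and>
     (\<forall>f. evaluation_functional f \<longrightarrow> standard_brownian_motion P (\<lambda>t \<omega>. f (B t \<omega>)))"

end

theory Submission
  imports Defs
begin

text \<open>
  For every \<open>k \<in> K\<close> the evaluation \<open>N t = M t k\<close> is a real continuous martingale whose squared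
  increments along partitions of \<open>[0, T]\<close> sum up to \<open>T\<close> in \<open>L\<^sup>2\<close>. Orthogonality of martingale
  increments turns this into \<open>E (G (N t - N s)\<^sup>2) = (t - s) E G\<close> for bounded \<open>F s\<close>-measurable \<open>G\<close>.
  With \<open>\<phi> r = E (1\<^sub>A exp (i u (N r - N s)))\<close> and \<open>A \<in> F s\<close>, a second order Taylor expansion over a
  step of length \<open>h\<close> gives \<open>\<phi> (r + h) \<approx> (1 - u\<^sup>2 h / 2) \<phi> r\<close>. The errors along a partition are at
  most a constant times \<open>E (min 1 (max \<bar>\<Delta>N\<bar>) \<Sum> (\<Delta>N)\<^sup>2)\<close>, which vanishes in the limit by path
  continuity, so \<open>\<phi> t = P A exp (- u\<^sup>2 (t - s) / 2)\<close>. Levy's uniqueness theorem then yields both the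
  normal law of \<open>N t - N s\<close> and its independence of \<open>F s\<close>.

  What remains is the integrability of \<open>(norm (M t))\<^sup>2\<close>, a supremum over \<open>K\<close>. Since no
  evaluation of \<open>M\<close> vanishes identically, no point of the compact space \<open>K\<close> annihilates \<open>j\<close>. This
  forces \<open>X\<close> to be finite dimensional, and then finitely many evaluations control the norm on
  \<open>ck_r j\<close>.
\<close>

section \<open>Embeddings of compact convex sets\<close>

text \<open>Compactness of \<open>A\<close> bounds the distances to \<open>C\<close>, so that the
  supremum in \<open>hausdorff_dist\<close> really dominates each of them; closedness of
  \<open>C\<close> turns distance zero into membership.\<close>

lemma hausdorff_dist_eq_0_imp_subset:
  assumes "compact A" "closed C" "C \<noteq> {}" "hausdorff_dist A C = 0"
  shows "A \<subseteq> C"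
proof
  fix a assume a: "a \<in> A"
  have "compact ((\<lambda>a. infdist a C) ` A)"
    using assms(1) by (intro compact_continuous_image continuous_intros)
  then have "bdd_above ((\<lambda>a. infdist a C) ` A)"
    by (intro bounded_imp_bdd_above compact_imp_bounded)
  then have "infdist a C \<le> (SUP a\<in>A. infdist a C)"
    using a by (intro cSUP_upper)
  also have "\<dots> \<le> 0"
    using assms(4) unfolding hausdorff_dist_def by linarith
  finally have "infdist a C = 0"
    using infdist_nonneg[of a C] by linarith
  then show "a \<in> C"
    using assms in_closed_iff_infdist_zero by blast
qed

lemma hausdorff_dist_le:
  assumes "A \<noteq> {}" "C \<noteq> {}" "\<And>a. a \<in> A \<Longrightarrow> infdist a C \<le> e" "\<And>c. c \<in> C \<Longrightarrow> infdist c A \<le> e"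
  shows "hausdorff_dist A C \<le> e"
  unfolding hausdorff_dist_def using assms by (auto intro!: cSUP_least)

text \<open>Allows the axiom on \<open>j (convex hull (A \<union> C))\<close> to be applied to a
  finite hull one vertex at a time.\<close>

lemma convex_hull_hull_Un: "convex hull (convex hull A \<union> convex hull B) = convex hull (A \<union> B)"
proof (rule subset_antisym)
  show "convex hull (convex hull A \<union> convex hull B) \<subseteq> convex hull (A \<union> B)"
    by (intro hull_minimal Un_least hull_mono convex_convex_hull) auto
  show "convex hull (A \<union> B) \<subseteq> convex hull (convex hull A \<union> convex hull B)"
    by (intro hull_mono Un_mono hull_subset)
qed

lemma singleton_in_ck [simp]: "{x} \<in> ck"
  by (simp add: ck_def)

lemma finite_hull_in_ck: "finite S \<Longrightarrow> S \<noteq> {} \<Longrightarrow> convex hull S \<in> ck"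
  by (simp add: ck_def finite_imp_compact_convex_hull)

section \<open>Order, linearity and norm properties that follow from the embedding axioms\<close>

context
  fixes j :: "'x::banach set \<Rightarrow> ('k::t2_space \<Rightarrow>\<^sub>C real)"
  assumes emb: "ck_embedding j"
begin

lemma embedding_dist:
  assumes "A \<in> ck" "C \<in> ck"
  shows "norm (j A - j C) = hausdorff_dist A C"
proof -
  have "\<forall>A\<in>ck. \<forall>C\<in>ck. hausdorff_dist A C = norm (j A - j C)"
    using emb unfolding ck_embedding_def by (elim conjE)
  then show ?thesis using assms by metis
qed

lemma embedding_hull:
  assumes "A \<in> ck" "C \<in> ck"
  shows "j (convex hull (A \<union> C)) = CK_sup (j A) (j C)"
proof -
  have "\<forall>A\<in>ck. \<forall>C\<in>ck. j (convex hull (A \<union> C)) = CK_sup (j A) (j C)"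
    using emb unfolding ck_embedding_def by (elim conjE)
  then show ?thesis using assms by blast
qed

lemma embedding_singleton_lin:
  assumes "\<alpha> \<ge> 0" "\<beta> \<ge> 0"
  shows "j {\<alpha> *\<^sub>R x + \<beta> *\<^sub>R y} = \<alpha> *\<^sub>R j {x} + \<beta> *\<^sub>R j {y}"
proof -
  have "\<forall>A\<in>ck. \<forall>C\<in>ck. \<forall>\<alpha>\<ge>0. \<forall>\<beta>\<ge>0.
      j {\<alpha> *\<^sub>R a + \<beta> *\<^sub>R c | a c. a \<in> A \<and> c \<in> C} = \<alpha> *\<^sub>R j A + \<beta> *\<^sub>R j C"
    using emb unfolding ck_embedding_def by (elim conjE)
  from this[rule_format, OF singleton_in_ck[of x] singleton_in_ck[of y] assms]
  show ?thesis by simp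
qed

lemma embedding_zero [simp]: "j {0} = 0"
  using embedding_singleton_lin[of 0 0 0 0] by simp

lemma embedding_singleton_scale: "\<alpha> \<ge> 0 \<Longrightarrow> j {\<alpha> *\<^sub>R x} = \<alpha> *\<^sub>R j {x}"
  using embedding_singleton_lin[of \<alpha> 0 x 0] by simp

text \<open>The embedding axioms speak of nonnegative coefficients only, but singletons have
  inverses under Minkowski addition, so \<open>j\<close> is fully linear on them.\<close>

lemma embedding_singleton_uminus: "j {- x} = - j {x}"
proof -
  have "j {x} + j {- x} = 0"
    using embedding_singleton_lin[of 1 1 x "- x"] by simp
  then show ?thesis by (simp add: add_eq_0_iff)
qed

lemma embedding_singleton_dist: "norm (j {x} - j {y}) = dist x y"
  by (simp add: embedding_dist hausdorff_dist_def dist_commute)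

text \<open>Inclusion means that the hull of the union is \<open>C\<close> itself, and the embedding
  turns this hull into a maximum.\<close>

lemma embedding_mono:
  assumes "A \<in> ck" "C \<in> ck" "A \<subseteq> C"
  shows "j A k \<le> j C k"
proof -
  have "convex hull (A \<union> C) = C"
    using assms by (simp add: Un_absorb1 ck_def hull_same)
  then have "j C = CK_sup (j A) (j C)"
    using embedding_hull assms by metis
  then have "j C k = max (j A k) (j C k)"
    by (metis apply_CK_sup)
  then show ?thesis by simp
qed

text \<open>A converse of monotonicity, in the role of a separation theorem: the pointwise bound
  says that adjoining \<open>x\<close> does not change the image under \<open>j\<close>, and an
  isometry cannot identify two different compact sets.\<close>

lemma embedding_le_imp_in_hull:
  assumes "finite S" "S \<noteq> {}" "\<And>k. j {x} k \<le> j (convex hull S) k"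
  shows "x \<in> convex hull S"
proof -
  let ?C = "convex hull S"
  have C: "?C \<in> ck" "insert x S \<noteq> {}"
    using assms by (auto simp: finite_hull_in_ck)
  have eq: "convex hull ({x} \<union> ?C) = convex hull (insert x S)"
    using convex_hull_hull_Un[of "{x}" S] by simp
  have D: "convex hull (insert x S) \<in> ck"
    using assms(1) by (intro finite_hull_in_ck) auto
  have "j (convex hull (insert x S)) = CK_sup (j {x}) (j ?C)"
    using embedding_hull[of "{x}" ?C] C eq by simp
  also have "\<dots> = j ?C"
    using assms(3) by (intro bcontfun_eqI) simp
  finally have "hausdorff_dist (convex hull (insert x S)) ?C = 0"
    using embedding_dist[OF D C(1)] by simp
  then have "convex hull (insert x S) \<subseteq> ?C"
    using C D by (intro hausdorff_dist_eq_0_imp_subset) (auto simp: ck_def compact_imp_closed)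
  then show ?thesis
    using hull_inc[of x "insert x S"] by auto
qed

text \<open>On a finite hull \<open>j\<close> is the pointwise maximum over the vertices, so at each
  fixed \<open>k\<close> some vertex attains it.\<close>

lemma embedding_hull_finite:
  assumes "finite S" "S \<noteq> {}"
  shows "\<exists>x\<in>S. j (convex hull S) k = j {x} k"
  using assms
proof (induction rule: finite_ne_induct)
  case (singleton x)
  then show ?case by simp
next
  case (insert x S)
  have "convex hull ({x} \<union> convex hull S) = convex hull (insert x S)"
    using convex_hull_hull_Un[of "{x}" S] by simp
  then have "j (convex hull (insert x S)) = CK_sup (j {x}) (j (convex hull S))"
    using embedding_hull[of "{x}" "convex hull S"] insert by (simp add: finite_hull_in_ck)
  then have "j (convex hull (insert x S)) k = max (j {x} k) (j (convex hull S) k)"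
    by simp
  then show ?case using insert.IH by (auto simp: max_def)
qed

text \<open>By total boundedness, \<open>j A\<close> is a uniform limit of the functions \<open>j (convex hull S)\<close> with
  \<open>S \<subseteq> A\<close> finite.\<close>

lemma embedding_singleton_pos:
  assumes A: "A \<in> ck" and ne: "j A k \<noteq> 0"
  shows "\<exists>x. j {x} k > 0"
proof (rule ccontr)
  assume "\<not> ?thesis"
  then have nonpos: "j {x} k \<le> 0" for x by (meson not_less)
  have zero: "j {x} k = 0" for x
    using nonpos[of x] nonpos[of "- x"] by (simp add: embedding_singleton_uminus)
  have le: "\<bar>j A k\<bar> \<le> e" if "e > 0" for e
  proof -
    have "compact A" "A \<noteq> {}" "convex A" using A by (auto simp: ck_def)
    then obtain S where S: "finite S" "S \<subseteq> A" "A \<subseteq> (\<Union>x\<in>S. ball x e)"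
      using compactE_image[of A A "\<lambda>x. ball x e"] \<open>e > 0\<close> by (metis UN_I centre_in_ball open_ball subsetI)
    then have ne: "S \<noteq> {}" using \<open>A \<noteq> {}\<close> by auto
    have sub: "convex hull S \<subseteq> A" using S \<open>convex A\<close> by (simp add: hull_minimal)
    have "hausdorff_dist A (convex hull S) \<le> e"
    proof (rule hausdorff_dist_le)
      fix a assume "a \<in> A"
      then obtain x where x: "x \<in> S" "dist x a < e" using S by auto
      then have "x \<in> convex hull S" by (simp add: hull_inc)
      then show "infdist a (convex hull S) \<le> e"
        using x by (intro infdist_le2[of x]) (auto simp: dist_commute)
    next
      fix c assume "c \<in> convex hull S"
      then show "infdist c A \<le> e" using sub \<open>e > 0\<close> by (simp add: subset_iff)
    qed (use \<open>A \<noteq> {}\<close> ne in auto)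
    then have "norm (j A - j (convex hull S)) \<le> e"
      using A S ne by (simp add: embedding_dist finite_hull_in_ck)
    then have "norm ((j A - j (convex hull S)) k) \<le> e"
      by (rule order_trans[OF norm_bounded])
    moreover have "j (convex hull S) k = 0"
      using embedding_hull_finite[OF S(1) ne] zero by metis
    ultimately show ?thesis by simp
  qed
  have "\<bar>j A k\<bar> \<le> 0" by (rule field_le_epsilon) (use le in simp)
  then show False using ne by simp
qed

text \<open>If no point of \<open>K\<close> annihilates \<open>j\<close>, then some finite hull \<open>C\<close> has \<open>j C \<ge> \<epsilon> > 0\<close>, so \<open>C\<close>
  contains a ball and \<open>X\<close> is finite dimensional. Compactness of the unit sphere then yields
  finitely many points of \<open>K\<close> that control every \<open>j A\<close>.\<close>

lemma embedding_sphere_compact: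
  assumes K: "compact (UNIV :: 'k set)" and ne: "\<And>k. \<exists>A\<in>ck. j A k \<noteq> 0"
  shows "compact (sphere (0::'x) 1)"
proof -
  have "\<exists>x. j {x} k > 0" for k
    using ne[of k] embedding_singleton_pos by blast
  then have cover: "UNIV \<subseteq> (\<Union>x\<in>UNIV. {k. j {x} k > 0})" by auto
  have op: "open {k. j {x} k > 0}" for x
    by (intro open_Collect_less continuous_intros) auto
  obtain S where S: "finite S" "UNIV \<subseteq> (\<Union>x\<in>S. {k. j {x} k > 0})"
    using compactE_image[OF K _ cover] op by auto
  then have Sne: "S \<noteq> {}" by auto
  define C where "C = convex hull S"
  have C: "C \<in> ck" using S Sne by (simp add: C_def finite_hull_in_ck)
  have pos: "j C k > 0" for k
  proof -
    obtain x where "x \<in> S" "j {x} k > 0" using S by auto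
    moreover have "j {x} k \<le> j C k"
      using C \<open>x \<in> S\<close> by (intro embedding_mono) (auto simp: C_def hull_inc)
    ultimately show ?thesis by simp
  qed
  obtain k0 where k0: "\<And>k. j C k0 \<le> j C k"
    using continuous_attains_inf[OF K, of "j C"] by auto
  define e where "e = j C k0"
  have e: "e > 0" by (simp add: e_def pos)
  \<comment> \<open>For a unit vector \<open>x\<close> the image of \<open>e *\<^sub>R x\<close> has
    norm \<open>e\<close> by isometry. It therefore stays below the minimum \<open>e\<close> of
    \<open>j C\<close>, and this domination puts \<open>e *\<^sub>R x\<close> into
    \<open>C\<close>.\<close>
  have "sphere 0 1 \<subseteq> (\<lambda>x. (1/e) *\<^sub>R x) ` C"
  proof
    fix x :: 'x assume x: "x \<in> sphere 0 1"
    have "j {e *\<^sub>R x} k \<le> j C k" for k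
    proof -
      have "norm (j {e *\<^sub>R x} k) \<le> norm (j {e *\<^sub>R x})" by (rule norm_bounded)
      also have "\<dots> = e"
        using embedding_singleton_dist[of "e *\<^sub>R x" 0] x e by simp
      finally show ?thesis using k0[of k] by (simp add: e_def)
    qed
    then have "e *\<^sub>R x \<in> C" unfolding C_def using S Sne by (intro embedding_le_imp_in_hull)
    then show "x \<in> (\<lambda>x. (1/e) *\<^sub>R x) ` C" using e by (intro image_eqI[of _ _ "e *\<^sub>R x"]) auto
  qed
  moreover have "compact ((\<lambda>x. (1/e) *\<^sub>R x) ` C)"
    using C by (intro compact_scaling) (auto simp: ck_def)
  moreover have "closed (sphere (0::'x) 1)"
    unfolding sphere_def by (intro closed_Collect_eq continuous_intros)
  ultimately show ?thesis
    by (metis compact_Int_closed inf.absorb2)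
qed

lemma embedding_norm_bound:
  assumes K: "compact (UNIV :: 'k set)" and ne: "\<And>k. \<exists>A\<in>ck. j A k \<noteq> 0"
  obtains S c where "finite S" "\<And>A. A \<in> ck \<Longrightarrow> norm (j A) \<le> c * (\<Sum>k\<in>S. \<bar>j A k\<bar>)"
proof -
  let ?B = "sphere (0::'x) 1"
  have cont: "continuous_on UNIV (\<lambda>x. j {x} k)" for k
  proof (rule continuous_on_subset[OF lipschitz_on_continuous_on[of 1]])
    show "1-lipschitz_on UNIV (\<lambda>x. j {x} k)"
    proof (rule lipschitz_onI)
      fix x y
      have "norm ((j {x} - j {y}) k) \<le> dist x y"
        unfolding embedding_singleton_dist[symmetric] by (rule norm_bounded)
      then show "dist (j {x} k) (j {y} k) \<le> 1 * dist x y" by (simp add: dist_norm)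
    qed auto
  qed auto
  \<comment> \<open>If no evaluation at \<open>x\<close> were positive, then \<open>x\<close> would
    be dominated by the hull of \<open>{0}\<close> and hence be zero.\<close>
  have ex: "\<exists>k. j {x} k > 0" if "x \<in> ?B" for x
  proof (rule ccontr)
    assume "\<not> ?thesis"
    then have "j {x} k \<le> j (convex hull {0}) k" for k
      by (simp add: not_less)
    from embedding_le_imp_in_hull[OF _ _ this] have "x = 0" by simp
    then show False using that by simp
  qed
  have cover: "?B \<subseteq> (\<Union>k\<in>UNIV. {x. j {x} k > 0})" using ex by auto
  have op: "open {x. j {x} k > 0}" for k
    by (intro open_Collect_less cont continuous_intros)
  obtain S where S: "finite S" "?B \<subseteq> (\<Union>k\<in>S. {x. j {x} k > 0})"
    using compactE_image[OF embedding_sphere_compact[OF K ne] _ cover] op by auto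
  \<comment> \<open>Only positive parts enter: \<open>embedding_mono\<close> bounds
    \<open>j {a} k\<close> by \<open>j A k\<close> from above and gives no bound from below.
    Positive homogeneity of \<open>g\<close> carries a bound on the sphere to the whole
    space.\<close>
  define g where "g x = (\<Sum>k\<in>S. max 0 (j {x} k))" for x
  have gpos: "g x > 0" if x: "x \<in> ?B" for x
  proof -
    obtain k where "k \<in> S" "j {x} k > 0" using x S by blast
    then show ?thesis unfolding g_def using S(1) by (intro sum_pos2[of S k]) auto
  qed
  obtain d where d: "d > 0" "\<And>x. x \<in> ?B \<Longrightarrow> d \<le> g x"
  proof (cases "?B = {}")
    \<comment> \<open>The space is trivial and the sphere empty, so any positive \<open>d\<close>
      serves.\<close>
    case True
    then show ?thesis using that[of 1] by auto
  next
    case False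
    have "continuous_on ?B g"
      unfolding g_def by (intro continuous_intros continuous_on_subset[OF cont]) auto
    from continuous_attains_inf[OF embedding_sphere_compact[OF K ne] False this] gpos that
    show ?thesis by metis
  qed
  have dg: "d * norm x \<le> g x" for x
  proof (cases "x = 0")
    case False
    have "j {x} = norm x *\<^sub>R j {sgn x}"
      using embedding_singleton_scale[of "norm x" "sgn x"] False by (simp add: sgn_div_norm)
    then have "g x = norm x * g (sgn x)"
      unfolding g_def by (simp add: sum_distrib_left max_mult_distrib_left)
    moreover have "d \<le> g (sgn x)" using False by (intro d) (simp add: norm_sgn)
    ultimately show ?thesis
      by (metis mult.commute mult_left_mono norm_ge_zero)
  qed (simp add: g_def sum_nonneg)
  show ?thesis
  proof (rule that[OF S(1), of "1/d"])
    fix A :: "'x set" assume A: "A \<in> ck"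
    then have Ane: "A \<noteq> {}" by (auto simp: ck_def)
    have bound: "norm a \<le> 1/d * (\<Sum>k\<in>S. \<bar>j A k\<bar>)" if "a \<in> A" for a
    proof -
      have "d * norm a \<le> g a" by (rule dg)
      also have "\<dots> \<le> (\<Sum>k\<in>S. \<bar>j A k\<bar>)"
        unfolding g_def
      proof (rule sum_mono)
        fix k
        have "j {a} k \<le> j A k" using A that by (intro embedding_mono) auto
        then show "max 0 (j {a} k) \<le> \<bar>j A k\<bar>" by simp
      qed
      finally show ?thesis using d(1) by (simp add: field_simps)
    qed
    obtain a0 where a0: "a0 \<in> A" using Ane by blast
    \<comment> \<open>As \<open>j {0} = 0\<close>, this distance is the norm of \<open>j A\<close>.
      The bound on single points of \<open>A\<close> controls both suprema in it.\<close>
    have "hausdorff_dist A {0} \<le> 1/d * (\<Sum>k\<in>S. \<bar>j A k\<bar>)"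
    proof (rule hausdorff_dist_le)
      fix a assume "a \<in> A"
      then show "infdist a {0} \<le> 1/d * (\<Sum>k\<in>S. \<bar>j A k\<bar>)" using bound by simp
    next
      fix c :: 'x assume "c \<in> {0}"
      then show "infdist c A \<le> 1/d * (\<Sum>k\<in>S. \<bar>j A k\<bar>)"
        using bound[OF a0] a0 by (intro infdist_le2[of a0]) auto
    qed (use Ane in auto)
    then show "norm (j A) \<le> 1/d * (\<Sum>k\<in>S. \<bar>j A k\<bar>)"
      using embedding_dist[OF A, of "{0}"] by simp
  qed
qed

end

section \<open>Bochner integrability of squares\<close>

lemma norm_CK_mult_le: "norm (CK_mult a b) \<le> norm a * norm b"
proof (rule norm_bound)
  fix x
  have "norm (apply_bcontfun a x) * norm (apply_bcontfun b x) \<le> norm a * norm b"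
    by (intro mult_mono norm_bounded) auto
  then show "norm (apply_bcontfun (CK_mult a b) x) \<le> norm a * norm b" by (simp add: abs_mult)
qed

lemma bounded_bilinear_CK_mult: "bounded_bilinear (CK_mult :: ('k::topological_space \<Rightarrow>\<^sub>C real) \<Rightarrow> _)"
proof
  fix a a' b b' :: "'k \<Rightarrow>\<^sub>C real" and r :: real
  show "CK_mult (a + a') b = CK_mult a b + CK_mult a' b"
    by (rule bcontfun_eqI) (simp add: algebra_simps)
  show "CK_mult a (b + b') = CK_mult a b + CK_mult a b'"
    by (rule bcontfun_eqI) (simp add: algebra_simps)
  show "CK_mult (r *\<^sub>R a) b = r *\<^sub>R CK_mult a b"
    by (rule bcontfun_eqI) simp
  show "CK_mult a (r *\<^sub>R b) = r *\<^sub>R CK_mult a b"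
    by (rule bcontfun_eqI) simp
  show "\<exists>K. \<forall>a b :: 'k \<Rightarrow>\<^sub>C real. norm (CK_mult a b) \<le> norm a * norm b * K"
    by (intro exI[of _ 1]) (simp add: norm_CK_mult_le)
qed

lemma bounded_linear_apply_bcontfun:
  "bounded_linear (\<lambda>x :: 'k::topological_space \<Rightarrow>\<^sub>C real. apply_bcontfun x k)"
proof
  show "\<exists>K. \<forall>x :: 'k \<Rightarrow>\<^sub>C real. norm (apply_bcontfun x k) \<le> norm x * K"
    by (intro exI[of _ 1]) (simp add: norm_bounded[where 'b=real, simplified])
qed simp_all

lemma borel_measurable_apply_bcontfun:
  fixes f :: "'a \<Rightarrow> ('k::topological_space \<Rightarrow>\<^sub>C real)"
  assumes "f \<in> borel_measurable M"
  shows "(\<lambda>\<omega>. f \<omega> k) \<in> borel_measurable M"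
  using assms
  by (intro borel_measurable_continuous_on[of "\<lambda>x. apply_bcontfun x k"]
      linear_continuous_on bounded_linear_apply_bcontfun)

text \<open>In a non-separable space differences of Borel functions need not be measurable, but
  subtracting a function with finitely many values is harmless.\<close>

lemma borel_measurable_norm_diff_simple:
  fixes f s :: "'a \<Rightarrow> 'b::real_normed_vector"
  assumes "f \<in> borel_measurable M" "simple_function M s"
  shows "(\<lambda>\<omega>. norm (f \<omega> - s \<omega>)) \<in> borel_measurable M"
proof (rule measurable_compose_countable'[where g=s and I="s ` space M"])
  fix i assume "i \<in> s ` space M"
  show "(\<lambda>\<omega>. norm (f \<omega> - i)) \<in> borel_measurable M"
    using assms by (intro borel_measurable_continuous_on[of "\<lambda>x. norm (x - i)"] continuous_intros)
next
  show "s \<in> M \<rightarrow>\<^sub>M count_space (s ` space M)"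
    using assms(2) by (auto intro!: measurable_count_space_eq2[THEN iffD2] simp: simple_function_def)
  show "countable (s ` space M)"
    using assms(2) by (simp add: simple_function_def countable_finite)
qed

text \<open>Taking norms leads to real-valued simple functions, for which the usual notion
  \<open>integrable\<close> applies whatever the size of the space of values.\<close>

lemma simple_bochner_integrable_norm_integrable:
  assumes "Bochner_Integration.simple_bochner_integrable M (s :: 'a \<Rightarrow> 'b::real_normed_vector)"
  shows "integrable M (\<lambda>\<omega>. norm (s \<omega>))"
proof -
  have "Bochner_Integration.simple_bochner_integrable M (\<lambda>\<omega>. norm (s \<omega>))"
    using assms by (intro simple_bochner_integrable_compose2[where p="\<lambda>x y. norm x", OF _ assms assms]) auto
  then show ?thesis
    by (intro integrableI_simple_bochner_integrable)
qed

text \<open>A single simple function at finite \<open>L1\<close> distance suffices, by the triangle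
  inequality.\<close>

lemma bochner_integrable_norm_integrable:
  assumes "bochner_integrable M f"
  shows "integrable M (\<lambda>\<omega>. norm (f \<omega>))"
proof -
  have f: "f \<in> borel_measurable M" using assms by (simp add: bochner_integrable_def)
  obtain s where s: "\<And>i. Bochner_Integration.simple_bochner_integrable M (s i)"
      "(\<lambda>i. \<integral>\<^sup>+ \<omega>. ennreal (norm (f \<omega> - s i \<omega>)) \<partial>M) \<longlonglongrightarrow> 0"
    using assms by (auto simp: bochner_integrable_def)
  have "eventually (\<lambda>i. (\<integral>\<^sup>+ \<omega>. ennreal (norm (f \<omega> - s i \<omega>)) \<partial>M) < 1) sequentially"
    using s(2) by (rule order_tendstoD) simp
  then obtain i where i: "(\<integral>\<^sup>+ \<omega>. ennreal (norm (f \<omega> - s i \<omega>)) \<partial>M) < 1"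
    by (auto simp: eventually_sequentially)
  have si: "simple_function M (s i)"
    using s(1)[of i] by (auto elim: simple_bochner_integrable.cases)
  have m [measurable]: "(\<lambda>\<omega>. norm (f \<omega> - s i \<omega>)) \<in> borel_measurable M"
    using f si by (rule borel_measurable_norm_diff_simple)
  have [measurable]: "(\<lambda>\<omega>. norm (f \<omega>)) \<in> borel_measurable M"
    using f by (rule measurable_compose) simp
  have "integrable M (\<lambda>\<omega>. norm (f \<omega> - s i \<omega>))"
    using i by (intro integrableI_bounded) (auto intro: less_trans)
  then have "integrable M (\<lambda>\<omega>. norm (f \<omega> - s i \<omega>) + norm (s i \<omega>))"
    using simple_bochner_integrable_norm_integrable[OF s(1)] by (intro Bochner_Integration.integrable_add)
  then show ?thesis
    by (rule Bochner_Integration.integrable_bound) (auto intro!: AE_I2 simp: norm_triangle_sub add.commute)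
qed

text \<open>The approximating simple functions of \<open>f\<close> are squared and then cut off where their norm
  exceeds twice a simple approximation of \<open>(norm f)\<^sup>2\<close>; dominated convergence applies along an almost
  everywhere convergent subsequence.\<close>

lemma (in finite_measure) bochner_integrable_CK_square:
  fixes f :: "'a \<Rightarrow> ('k::topological_space \<Rightarrow>\<^sub>C real)"
  assumes bi: "bochner_integrable M f" and int2: "integrable M (\<lambda>\<omega>. (norm (f \<omega>))\<^sup>2)"
  shows "bochner_integrable M (\<lambda>\<omega>. CK_mult (f \<omega>) (f \<omega>))"
proof -
  let ?sq = "\<lambda>x :: 'k \<Rightarrow>\<^sub>C real. CK_mult x x"
  have cont: "continuous_on UNIV ?sq"
    by (intro bounded_bilinear.continuous_on[OF bounded_bilinear_CK_mult] continuous_intros)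
  have f: "f \<in> borel_measurable M" using bi by (simp add: bochner_integrable_def)
  have fsq: "(\<lambda>\<omega>. ?sq (f \<omega>)) \<in> borel_measurable M"
    by (rule borel_measurable_continuous_on[OF cont f])
  have nf [measurable]: "(\<lambda>\<omega>. norm (f \<omega>)) \<in> borel_measurable M"
    using f by (rule measurable_compose) simp
  obtain s where s: "\<And>i. Bochner_Integration.simple_bochner_integrable M (s i)"
      "(\<lambda>i. \<integral>\<^sup>+ \<omega>. ennreal (norm (f \<omega> - s i \<omega>)) \<partial>M) \<longlonglongrightarrow> 0"
    using bi by (auto simp: bochner_integrable_def)
  have ss: "simple_function M (s i)" for i
    using s(1)[of i] by (auto elim: simple_bochner_integrable.cases)
  have m [measurable]: "(\<lambda>\<omega>. norm (f \<omega> - s i \<omega>)) \<in> borel_measurable M" for i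
    using f ss by (rule borel_measurable_norm_diff_simple)
  have intd: "integrable M (\<lambda>\<omega>. norm (f \<omega> - s i \<omega>))" for i
  proof (rule Bochner_Integration.integrable_bound)
    show "integrable M (\<lambda>\<omega>. norm (f \<omega>) + norm (s i \<omega>))"
      using bochner_integrable_norm_integrable[OF bi] simple_bochner_integrable_norm_integrable[OF s(1)]
      by (intro Bochner_Integration.integrable_add)
  qed (auto intro!: AE_I2 norm_triangle_ineq4)
  have "(\<lambda>i. enn2real (\<integral>\<^sup>+ \<omega>. ennreal (norm (f \<omega> - s i \<omega>)) \<partial>M)) \<longlonglongrightarrow> 0"
    using tendsto_enn2real[of _ 0 sequentially] s(2) by simp
  then have "(\<lambda>i. \<integral>\<omega>. norm (norm (f \<omega> - s i \<omega>)) \<partial>M) \<longlonglongrightarrow> 0"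
    by (simp add: integral_eq_nn_integral)
  from tendsto_L1_AE_subseq[OF intd this]
  obtain r where r: "strict_mono r" "AE \<omega> in M. (\<lambda>n. norm (f \<omega> - s (r n) \<omega>)) \<longlonglongrightarrow> 0"
    by auto
  have "(\<lambda>\<omega>. (norm (f \<omega>))\<^sup>2) \<in> borel_measurable M" by measurable
  from borel_measurable_implies_sequence_metric[OF this, of 0]
  obtain g where g: "\<And>i. simple_function M (g i)"
      "\<And>i \<omega>. \<omega> \<in> space M \<Longrightarrow> g i \<omega> \<le> 2 * (norm (f \<omega>))\<^sup>2"
      "\<And>\<omega>. \<omega> \<in> space M \<Longrightarrow> (\<lambda>i. g i \<omega>) \<longlonglongrightarrow> (norm (f \<omega>))\<^sup>2"
    by (simp add: abs_le_iff) blast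
  define p where "p (x :: 'k \<Rightarrow>\<^sub>C real) y = (if (norm x)\<^sup>2 \<le> 2 * y then ?sq x else 0)" for x and y :: real
  define q where "q i \<omega> = p (s (r i) \<omega>) (g i \<omega>)" for i \<omega>
  have q_simple: "simple_function M (q i)" for i
    unfolding q_def by (rule simple_function_compose2[OF ss g(1)])
  have q_bound: "norm (q i \<omega>) \<le> 4 * (norm (f \<omega>))\<^sup>2" if "\<omega> \<in> space M" for i \<omega>
  proof (cases "(norm (s (r i) \<omega>))\<^sup>2 \<le> 2 * g i \<omega>")
    case True
    then have "norm (q i \<omega>) \<le> (norm (s (r i) \<omega>))\<^sup>2"
      using norm_CK_mult_le[of "s (r i) \<omega>" "s (r i) \<omega>"] by (simp add: q_def p_def power2_eq_square)
    also have "\<dots> \<le> 2 * g i \<omega>" by (rule True)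
    finally show ?thesis using g(2)[OF that, of i] by linarith
  qed (simp add: q_def p_def)
  have fsq_bound: "norm (?sq (f \<omega>)) \<le> (norm (f \<omega>))\<^sup>2" for \<omega>
    using norm_CK_mult_le[of "f \<omega>" "f \<omega>"] by (simp add: power2_eq_square)
  have conv: "(\<lambda>i. norm (?sq (f \<omega>) - q i \<omega>)) \<longlonglongrightarrow> 0"
    if \<omega>: "\<omega> \<in> space M" and lim: "(\<lambda>n. norm (f \<omega> - s (r n) \<omega>)) \<longlonglongrightarrow> 0" for \<omega>
  proof (cases "f \<omega> = 0")
    \<comment> \<open>The cutoff need not become inactive here; instead the domination
      \<open>q_bound\<close> forces the approximations to vanish.\<close>
    case True
    then have "q i \<omega> = 0" for i using q_bound[OF \<omega>, of i] by simp
    then show ?thesis using True by (simp add: bounded_bilinear.zero_left[OF bounded_bilinear_CK_mult])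
  next
    case False
    have "(\<lambda>n. f \<omega> - s (r n) \<omega>) \<longlonglongrightarrow> 0" using lim by (simp add: tendsto_norm_zero_iff)
    from tendsto_diff[OF tendsto_const[of "f \<omega>"] this]
    have lims: "(\<lambda>n. s (r n) \<omega>) \<longlonglongrightarrow> f \<omega>" by simp
    \<comment> \<open>The factor 2 in the cutoff leaves the strictly positive gap
      \<open>(norm (f \<omega>))\<^sup>2\<close> in the limit, so the cutoff is eventually inactive
      at this point.\<close>
    have "(\<lambda>n. 2 * g n \<omega> - (norm (s (r n) \<omega>))\<^sup>2) \<longlonglongrightarrow> 2 * (norm (f \<omega>))\<^sup>2 - (norm (f \<omega>))\<^sup>2"
      by (intro tendsto_intros lims g \<omega>)
    then have "eventually (\<lambda>n. 2 * g n \<omega> - (norm (s (r n) \<omega>))\<^sup>2 > 0) sequentially"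
      by (rule order_tendstoD) (use False in simp)
    then have ev: "eventually (\<lambda>n. ?sq (s (r n) \<omega>) = q n \<omega>) sequentially"
      by eventually_elim (simp add: q_def p_def)
    have "(\<lambda>n. ?sq (s (r n) \<omega>)) \<longlonglongrightarrow> ?sq (f \<omega>)"
      by (intro bounded_bilinear.tendsto[OF bounded_bilinear_CK_mult] lims)
    then have "(\<lambda>n. q n \<omega>) \<longlonglongrightarrow> ?sq (f \<omega>)" by (rule Lim_transform_eventually[OF _ ev])
    from tendsto_norm[OF tendsto_diff[OF tendsto_const[of "?sq (f \<omega>)"] this]]
    show ?thesis by simp
  qed
  have "(\<lambda>i. \<integral>\<^sup>+ \<omega>. ennreal (norm (?sq (f \<omega>) - q i \<omega>)) \<partial>M) \<longlonglongrightarrow> (\<integral>\<^sup>+ \<omega>. 0 \<partial>M)"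
  \<comment> \<open>The constant 5 adds the 4 of \<open>q_bound\<close> to the 1 of
    \<open>fsq_bound\<close>.\<close>
  proof (rule nn_integral_dominated_convergence[where w="\<lambda>\<omega>. ennreal (5 * (norm (f \<omega>))\<^sup>2)"])
    show "(\<lambda>\<omega>. ennreal (norm (?sq (f \<omega>) - q i \<omega>))) \<in> borel_measurable M" for i
      using borel_measurable_norm_diff_simple[OF fsq q_simple[of i]] by measurable
    show "AE \<omega> in M. ennreal (norm (?sq (f \<omega>) - q i \<omega>)) \<le> ennreal (5 * (norm (f \<omega>))\<^sup>2)" for i
    proof (intro AE_I2 ennreal_leI)
      fix \<omega> assume \<omega>: "\<omega> \<in> space M"
      show "norm (?sq (f \<omega>) - q i \<omega>) \<le> 5 * (norm (f \<omega>))\<^sup>2"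
        using norm_triangle_ineq4[of "?sq (f \<omega>)" "q i \<omega>"] q_bound[OF \<omega>, of i] fsq_bound[of \<omega>]
        by linarith
    qed
    have "integrable M (\<lambda>\<omega>. 5 * (norm (f \<omega>))\<^sup>2)" using int2 by simp
    then have "(\<integral>\<^sup>+ \<omega>. ennreal (norm (5 * (norm (f \<omega>))\<^sup>2)) \<partial>M) < \<infinity>"
      unfolding integrable_iff_bounded by blast
    then show "(\<integral>\<^sup>+ \<omega>. ennreal (5 * (norm (f \<omega>))\<^sup>2) \<partial>M) < \<infinity>"
      by simp
    show "AE \<omega> in M. (\<lambda>i. ennreal (norm (?sq (f \<omega>) - q i \<omega>))) \<longlonglongrightarrow> 0"
      using r(2) AE_space
    proof eventually_elim
      case (elim \<omega>)
      from tendsto_ennrealI[OF conv[OF elim(2,1)]] show ?case by simp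
    qed
  qed (auto)
  moreover have "Bochner_Integration.simple_bochner_integrable M (q i)" for i
    using q_simple by (intro simple_bochner_integrable.intros) auto
  ultimately show ?thesis
    using fsq by (auto simp: bochner_integrable_def)
qed

section \<open>Real martingales with quadratic variation \<open>t\<close>\<close>

lemma (in finite_measure) integrable_bounded_mult:
  fixes G X :: "'a \<Rightarrow> real"
  assumes "integrable M X" "G \<in> borel_measurable M" "\<And>\<omega>. \<bar>G \<omega>\<bar> \<le> B"
  shows "integrable M (\<lambda>\<omega>. G \<omega> * X \<omega>)"
proof (rule Bochner_Integration.integrable_bound[of M "\<lambda>\<omega>. B * X \<omega>"])
  show "AE \<omega> in M. norm (G \<omega> * X \<omega>) \<le> norm (B * X \<omega>)"
    using assms(3) by (intro AE_I2) (auto simp: abs_mult intro!: mult_right_mono order_trans[OF assms(3) abs_ge_self])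
qed (use assms in \<open>auto intro!: borel_measurable_times\<close>)

lemma integrable_mult_of_square_integrable:
  fixes f g :: "'a \<Rightarrow> real"
  assumes "f \<in> borel_measurable M" "g \<in> borel_measurable M"
    and "integrable M (\<lambda>x. (f x)\<^sup>2)" "integrable M (\<lambda>x. (g x)\<^sup>2)"
  shows "integrable M (\<lambda>x. f x * g x)"
proof (rule Bochner_Integration.integrable_bound[of M "\<lambda>x. (f x)\<^sup>2 + (g x)\<^sup>2"])
  have "\<bar>a * b\<bar> \<le> a\<^sup>2 + b\<^sup>2" for a b :: real
  proof -
    have "2 * (\<bar>a\<bar> * \<bar>b\<bar>) \<le> a\<^sup>2 + b\<^sup>2"
      using sum_squares_bound[of "\<bar>a\<bar>" "\<bar>b\<bar>"] by (simp add: mult.assoc)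
    moreover have "0 \<le> \<bar>a\<bar> * \<bar>b\<bar>" by simp
    ultimately show ?thesis by (simp only: abs_mult)
  qed
  then show "AE x in M. norm (f x * g x) \<le> norm ((f x)\<^sup>2 + (g x)\<^sup>2)" by (intro AE_I2) simp
qed (use assms in auto)

text \<open>The variance of the absolute value of \<open>g\<close> is nonnegative; where
  \<open>g\<close> is not measurable or not square integrable the right-hand side is
  infinite.\<close>

lemma (in prob_space) L1_le_L2_norm: "ennreal (\<integral>\<omega>. \<bar>g \<omega>\<bar> \<partial>M) \<le> L2_norm M g"
proof (cases "g \<in> borel_measurable M \<and> integrable M (\<lambda>\<omega>. (g \<omega>)\<^sup>2)")
  case True
  then have g: "g \<in> borel_measurable M" "integrable M (\<lambda>\<omega>. (g \<omega>)\<^sup>2)" by auto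
  then have "integrable M g" by (rule square_integrable_imp_integrable)
  then have "0 \<le> (\<integral>\<omega>. \<bar>g \<omega>\<bar>\<^sup>2 \<partial>M) - (\<integral>\<omega>. \<bar>g \<omega>\<bar> \<partial>M)\<^sup>2"
    using g variance_positive[of "\<lambda>\<omega>. \<bar>g \<omega>\<bar>"] by (subst variance_eq[symmetric]) auto
  then have "(\<integral>\<omega>. \<bar>g \<omega>\<bar> \<partial>M) \<le> sqrt (\<integral>\<omega>. (g \<omega>)\<^sup>2 \<partial>M)"
    by (intro real_le_rsqrt) simp
  then show ?thesis using True by (simp add: L2_norm_def ennreal_leI)
qed (auto simp: L2_norm_def)

section \<open>Partitions, meshes and equidistant grids\<close>

lemma mesh_map:
  assumes "0 < m"
  shows "mesh (map p [0..<Suc m]) = Max ((\<lambda>i. p (Suc i) - p i) ` {..<m})"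
  unfolding mesh_def by (rule arg_cong[where f=Max]) (auto simp del: upt_Suc intro!: image_cong)

text \<open>Makes the limit over all partitions available along one concrete sequence of them. The
  filter approaches 0 from the right, which is why the mesh is shown to be strictly positive as well
  as small.\<close>

lemma filterlim_mesh_to_0:
  assumes "T > 0" and p0: "\<And>n. p n 0 = 0" and pT: "\<And>n. p n (m n) = T"
    and inc: "\<And>n i. i < m n \<Longrightarrow> p n i < p n (Suc i)"
    and le: "\<And>n i. i < m n \<Longrightarrow> p n (Suc i) - p n i \<le> d n" and d: "d \<longlonglongrightarrow> 0"
  shows "filterlim (\<lambda>n. map (p n) [0..<Suc (m n)]) (mesh_to_0 T) sequentially"
proof -
  have m: "0 < m n" for n using p0[of n] pT[of n] \<open>T > 0\<close> by (metis less_irrefl not_gr_zero)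
  let ?ts = "\<lambda>n. map (p n) [0..<Suc (m n)]"
  have ub: "mesh (?ts n) \<le> d n" for n
    unfolding mesh_map[OF m] using m[of n] by (intro Max.boundedI) (auto intro!: le)
  have lb: "0 < mesh (?ts n)" for n
  proof -
    have "p n (Suc 0) - p n 0 \<le> mesh (?ts n)"
      unfolding mesh_map[OF m] using m by (intro Max_ge) auto
    then show ?thesis using inc[OF m, of n] by simp
  qed
  have "(\<lambda>n. mesh (?ts n)) \<longlonglongrightarrow> 0"
    by (rule tendsto_sandwich[OF _ _ tendsto_const d])
      (intro always_eventually allI less_imp_le lb, intro always_eventually allI ub)
  then have "filterlim (\<lambda>n. mesh (?ts n)) (at_right 0) sequentially"
    using lb by (intro tendsto_imp_filterlim_at_right) auto
  moreover have "?ts n \<in> partitions T" for n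
  proof -
    have "sorted_wrt (<) (?ts n)"
      using inc[of _ n] by (subst sorted_wrt_iff_nth_Suc_transp) (auto simp del: upt_Suc)
    moreover have "hd (?ts n) = 0" using p0 by (simp add: hd_map del: upt_Suc)
    moreover have "last (?ts n) = T" using pT by (simp add: last_map)
    ultimately show ?thesis by (simp add: partitions_def del: upt_Suc)
  qed
  ultimately show ?thesis
    unfolding mesh_to_0_def filterlim_inf filterlim_principal filterlim_filtercomap_iff
    by (simp add: o_def del: upt_Suc)
qed

lemma sum_lessThan_add: "(\<Sum>i<a + b. f i) = (\<Sum>i<a. f i) + (\<Sum>i<b. f (i + a))"
  for f :: "nat \<Rightarrow> 'b::comm_monoid_add"
  by (induction b) (simp_all add: add.assoc add.commute[of a])

text \<open>There are \<open>Suc n\<close> equal cells, so the index \<open>n = 0\<close> is no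
  degenerate case.\<close>

definition grid :: "real \<Rightarrow> real \<Rightarrow> nat \<Rightarrow> nat \<Rightarrow> real" where
  "grid a b n i = a + (b - a) * real i / real (Suc n)"

lemma grid_0 [simp]: "grid a b n 0 = a"
  and grid_end [simp]: "grid a b n (Suc n) = b"
  by (simp_all add: grid_def del: of_nat_Suc)

lemma grid_step: "grid a b n (Suc i) - grid a b n i = (b - a) / real (Suc n)"
proof -
  have *: "a + (b - a) * (1 + x) / y - (a + (b - a) * x / y) = (b - a) / y" for x y :: real
    by (cases "y = 0") (simp_all add: field_simps)
  show ?thesis unfolding grid_def of_nat_Suc[of i] by (rule *)
qed

lemma grid_less:
  assumes "a < b"
  shows "grid a b n i < grid a b n (Suc i)"
proof -
  have "0 < (b - a) / real (Suc n)" using assms by simp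
  then show ?thesis using grid_step[of a b n i] by linarith
qed

lemma grid_ge: "a \<le> b \<Longrightarrow> a \<le> grid a b n i"
  by (simp add: grid_def)

lemma mesh_tendsto_0: "(\<lambda>n. c / real (Suc n)) \<longlonglongrightarrow> 0"
  using LIMSEQ_Suc[OF lim_const_over_n[of c]] by simp

section \<open>Error accumulation and the Taylor remainder of the complex exponential\<close>

lemma iterate_error_bound:
  fixes a :: "nat \<Rightarrow> complex"
  assumes "norm q \<le> 1" "\<And>i. i < m \<Longrightarrow> norm (a (Suc i) - q * a i) \<le> e i"
  shows "norm (a m - q ^ m * a 0) \<le> (\<Sum>i<m. e i)"
  using assms(2)
proof (induction m)
  case (Suc m)
  \<comment> \<open>The new error is separated from the old one, which is only multiplied by
    \<open>q\<close> and so does not grow.\<close>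
  have "a (Suc m) - q ^ Suc m * a 0 = (a (Suc m) - q * a m) + q * (a m - q ^ m * a 0)"
    by (simp add: algebra_simps)
  then have "norm (a (Suc m) - q ^ Suc m * a 0) \<le> norm (a (Suc m) - q * a m) + norm (q * (a m - q ^ m * a 0))"
    by (metis norm_triangle_ineq)
  also have "norm (q * (a m - q ^ m * a 0)) \<le> norm (a m - q ^ m * a 0)"
    using assms(1) by (simp add: norm_mult mult_left_le_one_le)
  finally have "norm (a (Suc m) - q ^ Suc m * a 0) \<le> norm (a (Suc m) - q * a m) + norm (a m - q ^ m * a 0)"
    by simp
  moreover have "norm (a m - q ^ m * a 0) \<le> (\<Sum>i<m. e i)" "norm (a (Suc m) - q * a m) \<le> e m"
    using Suc by simp_all
  ultimately show ?case unfolding sum.lessThan_Suc by linarith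
qed simp

text \<open>Joins the cubic remainder bound, sharp for small \<open>x\<close>, with a quadratic one
  for large \<open>x\<close>, so that finite second moments suffice to integrate the error.\<close>

lemma norm_iexp_taylor2:
  "norm (iexp x - (1 + \<i> * x - x\<^sup>2 / 2)) \<le> x\<^sup>2 * min 1 \<bar>x\<bar>"
proof -
  have eq: "(\<Sum>k\<le>2. (\<i> * x) ^ k / fact k) = 1 + \<i> * x - x\<^sup>2 / 2"
    by (simp add: numeral_2_eq_2 power2_eq_square algebra_simps)
  have 1: "norm (iexp x - (1 + \<i> * x - x\<^sup>2 / 2)) \<le> x\<^sup>2"
    using iexp_approx2[of x 2] unfolding eq by (simp add: fact_numeral)
  have "norm (iexp x - (1 + \<i> * x - x\<^sup>2 / 2)) \<le> \<bar>x\<bar> ^ 3 / 6"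
    using iexp_approx1[of x 2] unfolding eq by (simp add: fact_numeral numeral_3_eq_3 numeral_2_eq_2)
  also have "\<dots> \<le> \<bar>x\<bar> ^ 3" by simp
  also have "\<dots> = x\<^sup>2 * \<bar>x\<bar>" by (simp add: power3_eq_cube power2_eq_square)
  finally show ?thesis using 1 by (simp add: min_def)
qed

text \<open>Collects what one evaluation of the set-valued martingale satisfies. Only first moments
  are assumed directly; second moments have to come out of \<open>qv\<close>.\<close>

locale levy_martingale = prob_space P for P :: "'a measure" +
  fixes F :: "real \<Rightarrow> 'a measure" and N :: "real \<Rightarrow> 'a \<Rightarrow> real"
  assumes filt: "filtration_on P F"
    and adapted: "\<And>t. t \<ge> 0 \<Longrightarrow> N t \<in> borel_measurable (F t)"
    and integrable_N: "\<And>t. t \<ge> 0 \<Longrightarrow> integrable P (N t)"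
    and mart: "\<And>s t. 0 \<le> s \<Longrightarrow> s < t \<Longrightarrow> AE \<omega> in P. real_cond_exp P (F s) (N t) \<omega> = N s \<omega>"
    and start: "AE \<omega> in P. N 0 \<omega> = 0"
    and cont: "AE \<omega> in P. continuous_on {0..} (\<lambda>t. N t \<omega>)"
    and qv: "\<And>T. T > 0 \<Longrightarrow> ((\<lambda>ts. L2_norm P
      (\<lambda>\<omega>. T - (\<Sum>i<length ts - 1. (N (ts ! Suc i) \<omega> - N (ts ! i) \<omega>)\<^sup>2))) \<longlongrightarrow> 0) (mesh_to_0 T)"
begin

section \<open>Second moments, and the quadratic variation on subintervals\<close>

lemma subalgebra_F: "t \<ge> 0 \<Longrightarrow> subalgebra P (F t)"
  using filt by (simp add: filtration_on_def)

lemma subalgebra_mono: "0 \<le> s \<Longrightarrow> s \<le> t \<Longrightarrow> subalgebra (F t) (F s)"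
  using filt by (auto simp: filtration_on_def subalgebra_def)

lemma measurable_F: "t \<ge> 0 \<Longrightarrow> X \<in> borel_measurable (F t) \<Longrightarrow> X \<in> borel_measurable P"
  using measurable_from_subalg[OF subalgebra_F] .

lemma measurable_F_mono:
  "0 \<le> s \<Longrightarrow> s \<le> t \<Longrightarrow> X \<in> borel_measurable (F s) \<Longrightarrow> X \<in> borel_measurable (F t)"
  using measurable_from_subalg[OF subalgebra_mono] .

lemma measurable_N [measurable]: "t \<ge> 0 \<Longrightarrow> N t \<in> borel_measurable P"
  using adapted measurable_F by blast

text \<open>\<open>L2_norm\<close> is infinite off the square integrable functions, so convergence
  to 0 itself yields integrability of the sums from some index on. The limit is then weakened to
  \<open>L1\<close>.\<close>

lemma qv_L1:
  assumes "T > 0" "\<And>n. p n 0 = 0" "\<And>n. p n (m n) = T"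
    "\<And>n i. i < m n \<Longrightarrow> p n i < p n (Suc i)"
    "\<And>n i. i < m n \<Longrightarrow> p n (Suc i) - p n i \<le> d n" "d \<longlonglongrightarrow> 0"
  defines "S \<equiv> \<lambda>n \<omega>. \<Sum>i<m n. (N (p n (Suc i)) \<omega> - N (p n i) \<omega>)\<^sup>2"
  shows "eventually (\<lambda>n. integrable P (S n)) sequentially"
    and "(\<lambda>n. \<integral>\<omega>. \<bar>T - S n \<omega>\<bar> \<partial>P) \<longlonglongrightarrow> 0"
proof -
  have S: "(\<Sum>i<length (map (p n) [0..<Suc (m n)]) - 1.
      (N (map (p n) [0..<Suc (m n)] ! Suc i) \<omega> - N (map (p n) [0..<Suc (m n)] ! i) \<omega>)\<^sup>2) = S n \<omega>" for n \<omega>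
    unfolding S_def by (auto simp del: upt_Suc intro!: sum.cong)
  have lim: "(\<lambda>n. L2_norm P (\<lambda>\<omega>. T - S n \<omega>)) \<longlonglongrightarrow> 0"
    using filterlim_compose[OF qv[OF assms(1)] filterlim_mesh_to_0[OF assms(1-6)]] unfolding S .
  then have "eventually (\<lambda>n. L2_norm P (\<lambda>\<omega>. T - S n \<omega>) < \<infinity>) sequentially"
    by (rule order_tendstoD) simp
  then show "eventually (\<lambda>n. integrable P (S n)) sequentially"
  proof eventually_elim
    case (elim n)
    have "integrable P (\<lambda>\<omega>. T - S n \<omega>)"
      by (rule square_integrable_imp_integrable) (use elim in \<open>auto simp: L2_norm_def split: if_splits\<close>)
    from Bochner_Integration.integrable_diff[OF integrable_const[of T] this]
    show ?case by simp
  qed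
  have "(\<lambda>n. ennreal (\<integral>\<omega>. \<bar>T - S n \<omega>\<bar> \<partial>P)) \<longlonglongrightarrow> 0"
    by (rule tendsto_sandwich[OF _ _ tendsto_const lim]) (simp, intro always_eventually allI L1_le_L2_norm)
  then show "(\<lambda>n. \<integral>\<omega>. \<bar>T - S n \<omega>\<bar> \<partial>P) \<longlonglongrightarrow> 0"
    using tendsto_enn2real[of "\<lambda>n. ennreal (\<integral>\<omega>. \<bar>T - S n \<omega>\<bar> \<partial>P)" 0 sequentially] by simp
qed

text \<open>One partition with integrable sum of squares is enough: \<open>N t\<close> is almost
  surely the sum of its increments, and Cauchy-Schwarz bounds its square by their number times that
  sum.\<close>

lemma square_integrable_N:
  assumes "t \<ge> 0"
  shows "integrable P (\<lambda>\<omega>. (N t \<omega>)\<^sup>2)"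
proof (cases "t = 0")
  case True
  have "integrable P (\<lambda>\<omega>. (N 0 \<omega>)\<^sup>2) \<longleftrightarrow> integrable P (\<lambda>\<omega>. 0 :: real)"
    using start by (intro integrable_cong_AE) auto
  then show ?thesis using True by simp
next
  case False
  then have t: "t > 0" using assms by simp
  define p where "p = grid 0 t"
  have p: "p n 0 = 0" "p n (Suc n) = t" "p n i < p n (Suc i)" "p n (Suc i) - p n i \<le> t / real (Suc n)" for n i
    using grid_less[OF t, of n i] grid_step[of 0 t n i] by (simp_all add: p_def del: of_nat_Suc)
  have "eventually (\<lambda>n. integrable P (\<lambda>\<omega>. \<Sum>i<Suc n. (N (p n (Suc i)) \<omega> - N (p n i) \<omega>)\<^sup>2)) sequentially"
    by (rule qv_L1(1)[OF t p(1,2) p(3) p(4) mesh_tendsto_0])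
  then obtain n where n: "integrable P (\<lambda>\<omega>. \<Sum>i<Suc n. (N (p n (Suc i)) \<omega> - N (p n i) \<omega>)\<^sup>2)"
    by (auto simp: eventually_sequentially)
  show ?thesis
  proof (rule Bochner_Integration.integrable_bound)
    show "integrable P (\<lambda>\<omega>. (\<Sum>i<Suc n. (N (p n (Suc i)) \<omega> - N (p n i) \<omega>)\<^sup>2) * card {..<Suc n})"
      using n by (rule integrable_mult_left)
    show "AE \<omega> in P. norm ((N t \<omega>)\<^sup>2) \<le> norm ((\<Sum>i<Suc n. (N (p n (Suc i)) \<omega> - N (p n i) \<omega>)\<^sup>2) * card {..<Suc n})"
      using start
    proof eventually_elim
      case (elim \<omega>)
      have "N t \<omega> = (\<Sum>i<Suc n. N (p n (Suc i)) \<omega> - N (p n i) \<omega>)"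
        using elim sum_lessThan_telescope[of "\<lambda>i. N (p n i) \<omega>" "Suc n"]
        by (simp only: p diff_zero)
      then show ?case
        using sum_squared_le_sum_of_squares[of "\<lambda>i. N (p n (Suc i)) \<omega> - N (p n i) \<omega>" "{..<Suc n}"]
        by (simp only: real_norm_def abs_power2)
    qed
  qed (use t in simp)
qed

lemma integrable_increment_square:
  assumes "r \<ge> 0" "t \<ge> 0"
  shows "integrable P (\<lambda>\<omega>. (N t \<omega> - N r \<omega>)\<^sup>2)"
proof -
  have "integrable P (\<lambda>\<omega>. (N t \<omega>)\<^sup>2 + (N r \<omega>)\<^sup>2 - 2 * (N t \<omega> * N r \<omega>))"
    using assms by (intro Bochner_Integration.integrable_diff Bochner_Integration.integrable_add
      integrable_mult_right square_integrable_N integrable_mult_of_square_integrable) auto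
  then show ?thesis by (simp add: power2_diff mult.assoc)
qed

text \<open>The assumption concerns intervals starting at 0. A grid of \<open>[0, s]\<close>
  followed by one of \<open>[s, t]\<close> partitions \<open>[0, t]\<close>; subtracting the limit
  over the first piece from that over the whole leaves the second.\<close>

lemma qv_interval:
  assumes "0 \<le> s" "s < t"
  shows "(\<lambda>n. \<integral>\<omega>. \<bar>(t - s) - (\<Sum>i<Suc n. (N (grid s t n (Suc i)) \<omega> - N (grid s t n i) \<omega>)\<^sup>2)\<bar> \<partial>P) \<longlonglongrightarrow> 0"
proof -
  define S where "S a b n \<omega> = (\<Sum>i<Suc n. (N (grid a b n (Suc i)) \<omega> - N (grid a b n i) \<omega>)\<^sup>2)" for a b n \<omega>
  have base: "(\<lambda>n. \<integral>\<omega>. \<bar>t - S 0 t n \<omega>\<bar> \<partial>P) \<longlonglongrightarrow> 0" if "t > 0" for t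
    unfolding S_def
    by (rule qv_L1(2)[where p="grid 0 t" and m=Suc, OF that _ _ _ _ mesh_tendsto_0[of t]])
      (use grid_less[OF that] grid_step[of 0 t] in \<open>simp_all del: of_nat_Suc\<close>)
  have intS: "integrable P (S a b n)" if "0 \<le> a" "a < b" for a b n
  proof -
    have "0 \<le> grid a b n i" for i
      by (rule order_trans[OF that(1) grid_ge]) (use that in simp)
    then show ?thesis
      unfolding S_def by (intro Bochner_Integration.integrable_sum integrable_increment_square)
  qed
  have "(\<lambda>n. \<integral>\<omega>. \<bar>(t - s) - S s t n \<omega>\<bar> \<partial>P) \<longlonglongrightarrow> 0"
  proof (cases "s = 0")
    case True
    then show ?thesis using base assms by simp
  next
    case False
    then have s: "s > 0" using assms by simp
    \<comment> \<open>The two grids share the point \<open>s\<close> at index \<open>Suc n\<close>,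
      so either formula is valid there. Both cell widths are at most
      \<open>t / real (Suc n)\<close>.\<close>
    define q where "q n i = (if i \<le> Suc n then grid 0 s n i else grid s t n (i - Suc n))" for n i
    have q_lo: "q n i = grid 0 s n i" if "i \<le> Suc n" for n i using that by (simp add: q_def)
    have q_hi: "q n (i + Suc n) = grid s t n i" for n i
      by (cases i) (auto simp: q_def)
    have q_step: "q n i < q n (Suc i) \<and> q n (Suc i) - q n i \<le> t / real (Suc n)" for n i
    proof (cases "Suc i \<le> Suc n")
      case True
      then show ?thesis
        using grid_less[OF s, of n i] grid_step[of 0 s n i] assms
        by (simp add: q_lo divide_right_mono del: of_nat_Suc)
    next
      case False
      then have "i = (i - Suc n) + Suc n" by simp
      then obtain k where "i = k + Suc n" by blast
      then have "q n i = grid s t n k" "q n (Suc i) = grid s t n (Suc k)"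
        using q_hi[of n k] q_hi[of n "Suc k"] by simp_all
      then show ?thesis
        using grid_less[OF assms(2), of n k] grid_step[of s t n k] assms
        by (simp add: divide_right_mono del: of_nat_Suc)
    qed
    have split: "(\<Sum>i<2 * Suc n. (N (q n (Suc i)) \<omega> - N (q n i) \<omega>)\<^sup>2) = S 0 s n \<omega> + S s t n \<omega>" for n \<omega>
    proof -
      have "(\<Sum>i<2 * Suc n. (N (q n (Suc i)) \<omega> - N (q n i) \<omega>)\<^sup>2) =
          (\<Sum>i<Suc n. (N (q n (Suc i)) \<omega> - N (q n i) \<omega>)\<^sup>2) +
          (\<Sum>i<Suc n. (N (q n (Suc (i + Suc n))) \<omega> - N (q n (i + Suc n)) \<omega>)\<^sup>2)"
        unfolding mult_2 by (rule sum_lessThan_add)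
      also have "(\<Sum>i<Suc n. (N (q n (Suc i)) \<omega> - N (q n i) \<omega>)\<^sup>2) = S 0 s n \<omega>"
        unfolding S_def by (rule sum.cong) (auto simp: q_lo)
      also have "(\<Sum>i<Suc n. (N (q n (Suc (i + Suc n))) \<omega> - N (q n (i + Suc n)) \<omega>)\<^sup>2) = S s t n \<omega>"
        unfolding S_def add_Suc[symmetric] q_hi by (rule refl)
      finally show ?thesis .
    qed
    have t: "t > 0" using assms s by simp
    have whole: "(\<lambda>n. \<integral>\<omega>. \<bar>t - (S 0 s n \<omega> + S s t n \<omega>)\<bar> \<partial>P) \<longlonglongrightarrow> 0"
      unfolding split[symmetric]
    proof (rule qv_L1(2)[where d="\<lambda>n. t / real (Suc n)", OF t _ _ _ _ mesh_tendsto_0])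
      show "q n 0 = 0" for n by (simp add: q_lo)
      show "q n (2 * Suc n) = t" for n
        using q_hi[of n "Suc n"] by (simp add: mult_2)
    qed (use q_step in auto)
    have "(\<lambda>n. (\<integral>\<omega>. \<bar>t - (S 0 s n \<omega> + S s t n \<omega>)\<bar> \<partial>P) + (\<integral>\<omega>. \<bar>s - S 0 s n \<omega>\<bar> \<partial>P)) \<longlonglongrightarrow> 0"
      using tendsto_add[OF whole base[OF s]] by simp
    then show ?thesis
    proof (rule tendsto_sandwich[OF _ _ tendsto_const, rotated 2])
      show "eventually (\<lambda>n. (\<integral>\<omega>. \<bar>(t - s) - S s t n \<omega>\<bar> \<partial>P) \<le>
        (\<integral>\<omega>. \<bar>t - (S 0 s n \<omega> + S s t n \<omega>)\<bar> \<partial>P) + (\<integral>\<omega>. \<bar>s - S 0 s n \<omega>\<bar> \<partial>P)) sequentially"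
      proof (rule always_eventually, rule allI)
        fix n
        have i: "integrable P (S 0 s n)" "integrable P (S s t n)" using intS s assms by auto
        have "(\<integral>\<omega>. \<bar>(t - s) - S s t n \<omega>\<bar> \<partial>P) \<le>
            (\<integral>\<omega>. \<bar>t - (S 0 s n \<omega> + S s t n \<omega>)\<bar> + \<bar>s - S 0 s n \<omega>\<bar> \<partial>P)"
          using i by (intro integral_mono) auto
        also have "\<dots> = (\<integral>\<omega>. \<bar>t - (S 0 s n \<omega> + S s t n \<omega>)\<bar> \<partial>P) + (\<integral>\<omega>. \<bar>s - S 0 s n \<omega>\<bar> \<partial>P)"
          using i by (intro Bochner_Integration.integral_add) auto
        finally show "(\<integral>\<omega>. \<bar>(t - s) - S s t n \<omega>\<bar> \<partial>P) \<le>
          (\<integral>\<omega>. \<bar>t - (S 0 s n \<omega> + S s t n \<omega>)\<bar> \<partial>P) + (\<integral>\<omega>. \<bar>s - S 0 s n \<omega>\<bar> \<partial>P)" .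
      qed
    qed (auto intro!: always_eventually)
  qed
  then show ?thesis unfolding S_def .
qed

section \<open>Orthogonality of martingale increments and their conditional variance\<close>

lemma integral_mult_N:
  assumes "0 \<le> s" "s \<le> t" "G \<in> borel_measurable (F s)" "integrable P (\<lambda>\<omega>. G \<omega> * N t \<omega>)"
  shows "(\<integral>\<omega>. G \<omega> * N t \<omega> \<partial>P) = (\<integral>\<omega>. G \<omega> * N s \<omega> \<partial>P)"
proof (cases "s = t")
  case False
  then have st: "s < t" using assms by simp
  interpret finite_measure_subalgebra P "F s"
    by unfold_locales (rule subalgebra_F[OF assms(1)])
  have G: "G \<in> borel_measurable P" using assms measurable_F by blast
  have "(\<integral>\<omega>. G \<omega> * N t \<omega> \<partial>P) = (\<integral>\<omega>. G \<omega> * real_cond_exp P (F s) (N t) \<omega> \<partial>P)"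
    using assms by (intro real_cond_exp_intg(2)[symmetric]) auto
  also have "\<dots> = (\<integral>\<omega>. G \<omega> * N s \<omega> \<partial>P)"
    using mart[OF assms(1) st] G assms measurable_N[of s]
    by (intro integral_cong_AE) (auto intro!: borel_measurable_times)
  finally show ?thesis .
qed simp

lemma integral_increment:
  assumes "0 \<le> s" "s \<le> t" "G \<in> borel_measurable (F s)" "\<And>\<omega>. \<bar>G \<omega>\<bar> \<le> B"
  shows "(\<integral>\<omega>. G \<omega> * (N t \<omega> - N s \<omega>) \<partial>P) = 0"
proof -
  have G: "G \<in> borel_measurable P" using assms measurable_F by blast
  have i: "integrable P (\<lambda>\<omega>. G \<omega> * N r \<omega>)" if "r \<ge> 0" for r
    using that G assms by (intro integrable_bounded_mult integrable_N)
  show ?thesis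
    using integral_mult_N[OF assms(1-3) i] i assms by (simp add: right_diff_distrib)
qed

text \<open>By the martingale property the cross term \<open>N s * N t\<close> integrates like the
  square of \<open>N s\<close>. Weighted squared increments thus become differences, which telescope
  along a partition.\<close>

lemma integral_increment_square_telescope:
  assumes "0 \<le> s" "s \<le> t" "G \<in> borel_measurable (F s)" "\<And>\<omega>. \<bar>G \<omega>\<bar> \<le> B"
  shows "(\<integral>\<omega>. G \<omega> * (N t \<omega> - N s \<omega>)\<^sup>2 \<partial>P) = (\<integral>\<omega>. G \<omega> * (N t \<omega>)\<^sup>2 \<partial>P) - (\<integral>\<omega>. G \<omega> * (N s \<omega>)\<^sup>2 \<partial>P)"
proof -
  have G: "G \<in> borel_measurable P" using assms measurable_F by blast
  have t: "t \<ge> 0" using assms by simp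
  have i2: "integrable P (\<lambda>\<omega>. G \<omega> * (N r \<omega>)\<^sup>2)" if "r \<ge> 0" for r
    using that G assms by (intro integrable_bounded_mult square_integrable_N)
  have im: "integrable P (\<lambda>\<omega>. G \<omega> * (N s \<omega> * N t \<omega>))"
    using G assms t by (intro integrable_bounded_mult integrable_mult_of_square_integrable square_integrable_N) auto
  \<comment> \<open>The weight \<open>G \<omega> * N s \<omega>\<close> may be unbounded;
    \<open>integral_mult_N\<close> asks only that its product with \<open>N t\<close> be
    integrable.\<close>
  have "(\<lambda>\<omega>. G \<omega> * N s \<omega>) \<in> borel_measurable (F s)"
    using assms adapted by (intro borel_measurable_times)
  then have cross: "(\<integral>\<omega>. G \<omega> * (N s \<omega> * N t \<omega>) \<partial>P) = (\<integral>\<omega>. G \<omega> * (N s \<omega>)\<^sup>2 \<partial>P)"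
    using integral_mult_N[OF assms(1,2), of "\<lambda>\<omega>. G \<omega> * N s \<omega>"] im
    by (simp add: mult.assoc power2_eq_square)
  have "(\<integral>\<omega>. G \<omega> * (N t \<omega> - N s \<omega>)\<^sup>2 \<partial>P) =
      (\<integral>\<omega>. G \<omega> * (N t \<omega>)\<^sup>2 + G \<omega> * (N s \<omega>)\<^sup>2 - 2 * (G \<omega> * (N s \<omega> * N t \<omega>)) \<partial>P)"
    by (intro Bochner_Integration.integral_cong refl) (simp add: power2_eq_square algebra_simps)
  also have "\<dots> = (\<integral>\<omega>. G \<omega> * (N t \<omega>)\<^sup>2 \<partial>P) + (\<integral>\<omega>. G \<omega> * (N s \<omega>)\<^sup>2 \<partial>P) - 2 * (\<integral>\<omega>. G \<omega> * (N s \<omega>)\<^sup>2 \<partial>P)"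
    using i2[OF t] i2[OF assms(1)] im cross by simp
  finally show ?thesis by simp
qed

text \<open>This says in weak form that the square of \<open>N t\<close> minus \<open>t\<close> is a
  martingale. Telescoping makes the weighted sum of squares have the same integral \<open>?c\<close>
  on every grid, while the unweighted sums converge to \<open>t - s\<close> in \<open>L1\<close>;
  boundedness of \<open>G\<close> lets the two be compared.\<close>

lemma integral_increment_square:
  assumes "0 \<le> s" "s \<le> t" "G \<in> borel_measurable (F s)" "\<And>\<omega>. \<bar>G \<omega>\<bar> \<le> B"
  shows "(\<integral>\<omega>. G \<omega> * (N t \<omega> - N s \<omega>)\<^sup>2 \<partial>P) = (t - s) * (\<integral>\<omega>. G \<omega> \<partial>P)"
proof (cases "s = t")
  case False
  then have st: "s < t" using assms by simp
  have G: "G \<in> borel_measurable P" using assms measurable_F by blast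
  have Gi: "integrable P G" using integrable_bounded_mult[OF integrable_const[of 1] G assms(4)] by simp
  define p where "p = grid s t"
  define S where "S n \<omega> = (\<Sum>i<Suc n. (N (p n (Suc i)) \<omega> - N (p n i) \<omega>)\<^sup>2)" for n \<omega>
  have p: "p n 0 = s" "p n (Suc n) = t" "p n i < p n (Suc i)" "p n i \<ge> s" for n i
    using st by (auto simp: p_def grid_less grid_ge)
  have p0: "p n i \<ge> 0" for n i using p(4) assms(1) order_trans by blast
  have intS: "integrable P (S n)" for n
    unfolding S_def by (intro Bochner_Integration.integrable_sum integrable_increment_square p0)
  have lim: "(\<lambda>n. \<integral>\<omega>. \<bar>(t - s) - S n \<omega>\<bar> \<partial>P) \<longlonglongrightarrow> 0"
    using qv_interval[OF assms(1) st] unfolding S_def p_def .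
  let ?c = "\<integral>\<omega>. G \<omega> * (N t \<omega> - N s \<omega>)\<^sup>2 \<partial>P"
  have c: "(\<integral>\<omega>. G \<omega> * S n \<omega> \<partial>P) = ?c" for n
  proof -
    let ?h = "\<lambda>i. \<integral>\<omega>. G \<omega> * (N (p n i) \<omega>)\<^sup>2 \<partial>P"
    have "(\<integral>\<omega>. G \<omega> * S n \<omega> \<partial>P) = (\<integral>\<omega>. (\<Sum>i<Suc n. G \<omega> * (N (p n (Suc i)) \<omega> - N (p n i) \<omega>)\<^sup>2) \<partial>P)"
      by (simp only: S_def sum_distrib_left)
    also have "\<dots> = (\<Sum>i<Suc n. \<integral>\<omega>. G \<omega> * (N (p n (Suc i)) \<omega> - N (p n i) \<omega>)\<^sup>2 \<partial>P)"
      using G assms(4) p0 by (intro Bochner_Integration.integral_sum integrable_bounded_mult integrable_increment_square)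
    also have "\<dots> = (\<Sum>i<Suc n. ?h (Suc i) - ?h i)"
      by (intro sum.cong refl integral_increment_square_telescope[where B=B] p0 less_imp_le[OF p(3)]
        measurable_F_mono[OF assms(1) p(4)] assms)
    also have "\<dots> = ?h (Suc n) - ?h 0" by (rule sum_lessThan_telescope)
    also have "\<dots> = ?c" unfolding p using assms by (intro integral_increment_square_telescope[symmetric])
    finally show ?thesis .
  qed
  have "\<bar>(t - s) * (\<integral>\<omega>. G \<omega> \<partial>P) - ?c\<bar> \<le> B * (\<integral>\<omega>. \<bar>(t - s) - S n \<omega>\<bar> \<partial>P)" for n
  proof -
    have iGS: "integrable P (\<lambda>\<omega>. G \<omega> * S n \<omega>)"
      using G assms(4) intS by (intro integrable_bounded_mult)
    have iD: "integrable P (\<lambda>\<omega>. (t - s) - S n \<omega>)" using intS by simp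
    have "(t - s) * (\<integral>\<omega>. G \<omega> \<partial>P) - ?c = (\<integral>\<omega>. (t - s) * G \<omega> - G \<omega> * S n \<omega> \<partial>P)"
      using Gi iGS c[of n] by simp
    also have "\<bar>\<dots>\<bar> \<le> (\<integral>\<omega>. \<bar>(t - s) * G \<omega> - G \<omega> * S n \<omega>\<bar> \<partial>P)"
      by (rule integral_abs_bound)
    also have "\<dots> \<le> (\<integral>\<omega>. B * \<bar>(t - s) - S n \<omega>\<bar> \<partial>P)"
    proof (rule integral_mono)
      fix \<omega>
      have "\<bar>(t - s) * G \<omega> - G \<omega> * S n \<omega>\<bar> = \<bar>G \<omega>\<bar> * \<bar>(t - s) - S n \<omega>\<bar>"
        by (simp add: abs_mult[symmetric] algebra_simps)
      also have "\<dots> \<le> B * \<bar>(t - s) - S n \<omega>\<bar>" by (intro mult_right_mono assms(4)) simp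
      finally show "\<bar>(t - s) * G \<omega> - G \<omega> * S n \<omega>\<bar> \<le> B * \<bar>(t - s) - S n \<omega>\<bar>" .
    qed (use Gi iGS iD in auto)
    finally show ?thesis by simp
  qed
  then have "\<bar>(t - s) * (\<integral>\<omega>. G \<omega> \<partial>P) - ?c\<bar> \<le> B * 0"
    by (intro LIMSEQ_le_const[OF tendsto_mult_left[OF lim]]) auto
  then show ?thesis by simp
qed simp

section \<open>Evolution of the characteristic function of an increment on an event\<close>

lemma integral_complex_mult_eq_0:
  fixes Z :: "'a \<Rightarrow> complex" and X :: "'a \<Rightarrow> real"
  assumes "Z \<in> borel_measurable P" "\<And>\<omega>. norm (Z \<omega>) \<le> 1" "integrable P X"
    and "(\<integral>\<omega>. Re (Z \<omega>) * X \<omega> \<partial>P) = 0" "(\<integral>\<omega>. Im (Z \<omega>) * X \<omega> \<partial>P) = 0"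
  shows "integrable P (\<lambda>\<omega>. Z \<omega> * X \<omega>)" "(\<integral>\<omega>. Z \<omega> * X \<omega> \<partial>P) = 0"
proof -
  show i: "integrable P (\<lambda>\<omega>. Z \<omega> * X \<omega>)"
  proof (rule Bochner_Integration.integrable_bound[OF assms(3)])
    show "AE \<omega> in P. norm (Z \<omega> * X \<omega>) \<le> norm (X \<omega>)"
      using assms(2) by (intro AE_I2) (simp add: norm_mult mult_left_le_one_le)
  qed (use assms in measurable)
  have "Re (\<integral>\<omega>. Z \<omega> * X \<omega> \<partial>P) = 0" "Im (\<integral>\<omega>. Z \<omega> * X \<omega> \<partial>P) = 0"
    using assms by (simp_all add: integral_Re[OF i, symmetric] integral_Im[OF i, symmetric])
  then show "(\<integral>\<omega>. Z \<omega> * X \<omega> \<partial>P) = 0" by (simp add: complex_eq_iff)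
qed

text \<open>For \<open>A\<close> of positive probability this is \<open>prob A\<close> times the
  characteristic function at \<open>u\<close> of \<open>N r - N s\<close> conditioned on
  \<open>A\<close>.\<close>

definition char_incr :: "'a set \<Rightarrow> real \<Rightarrow> real \<Rightarrow> real \<Rightarrow> complex" where
  "char_incr A u s r = (\<integral>\<omega>. indicator A \<omega> * iexp (u * (N r \<omega> - N s \<omega>)) \<partial>P)"

text \<open>The exponential at time \<open>t\<close> is the \<open>F r\<close>-measurable factor
  \<open>Z\<close> times that of the new increment \<open>D\<close>. In the Taylor expansion of the
  latter the linear term integrates to zero, the quadratic one has mean governed by
  \<open>t - r\<close>, and only the remainder is left to estimate.\<close>

lemma char_incr_step:
  assumes A: "A \<in> sets (F s)" and "0 \<le> s" "s \<le> r" "r \<le> t"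
  shows "norm (char_incr A u s t - complex_of_real (1 - u\<^sup>2 * (t - r) / 2) * char_incr A u s r)
    \<le> (\<integral>\<omega>. (u * (N t \<omega> - N r \<omega>))\<^sup>2 * min 1 \<bar>u * (N t \<omega> - N r \<omega>)\<bar> \<partial>P)"
proof -
  have r: "0 \<le> r" "0 \<le> t" using assms by auto
  define Z :: "'a \<Rightarrow> complex" where "Z \<omega> = indicator A \<omega> * iexp (u * (N r \<omega> - N s \<omega>))" for \<omega>
  define D where "D \<omega> = N t \<omega> - N r \<omega>" for \<omega>
  define R where "R x = iexp x - (1 + \<i> * x - x\<^sup>2 / 2)" for x :: real
  have [measurable]: "N r \<in> borel_measurable (F r)" "N s \<in> borel_measurable (F r)" "A \<in> sets (F r)"
    using adapted assms r measurable_F_mono[of s r "N s"] subalgebra_mono[of s r]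
    by (auto simp: subalgebra_def)
  have ZF [measurable]: "Z \<in> borel_measurable (F r)"
    unfolding Z_def by measurable
  have ZP: "Z \<in> borel_measurable P"
    using measurable_from_subalg[OF subalgebra_F[OF r(1)] ZF] .
  have Zn: "norm (Z \<omega>) \<le> 1" for \<omega>
    by (simp add: Z_def norm_mult indicator_def)
  have Re_le: "\<bar>Re (Z \<omega>)\<bar> \<le> 1" and Im_le: "\<bar>Im (Z \<omega>)\<bar> \<le> 1" for \<omega>
    using abs_Re_le_cmod[of "Z \<omega>"] abs_Im_le_cmod[of "Z \<omega>"] Zn[of \<omega>] by linarith+
  have iD: "integrable P D" and iD2: "integrable P (\<lambda>\<omega>. (D \<omega>)\<^sup>2)"
    unfolding D_def using integrable_N integrable_increment_square r by auto
  have iZ: "integrable P Z" by (rule integrable_const_bound[of _ 1]) (use Zn ZP in auto)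
  have bnd: "integrable P (\<lambda>\<omega>. Re (Z \<omega>))" "integrable P (\<lambda>\<omega>. Im (Z \<omega>))" using iZ by auto
  \<comment> \<open>The increment lemmas take real weights, so the real and imaginary parts of
    \<open>Z\<close> are treated separately.\<close>
  have Z1: "integrable P (\<lambda>\<omega>. Z \<omega> * D \<omega>)" "(\<integral>\<omega>. Z \<omega> * D \<omega> \<partial>P) = 0"
    using integral_complex_mult_eq_0[OF ZP Zn iD]
      integral_increment[OF r(1) assms(4) _ Re_le] integral_increment[OF r(1) assms(4) _ Im_le]
    by (auto simp: D_def)
  have iX: "integrable P (\<lambda>\<omega>. (D \<omega>)\<^sup>2 - (t - r))" using iD2 by simp
  have sq0: "(\<integral>\<omega>. G \<omega> * ((D \<omega>)\<^sup>2 - (t - r)) \<partial>P) = 0"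
    if "G \<in> borel_measurable (F r)" "\<And>\<omega>. \<bar>G \<omega>\<bar> \<le> 1" "integrable P G" for G
  proof -
    have "integrable P (\<lambda>\<omega>. G \<omega> * (D \<omega>)\<^sup>2)"
      using that measurable_F[OF r(1)] iD2 by (intro integrable_bounded_mult[where B=1])
    then have "(\<integral>\<omega>. G \<omega> * ((D \<omega>)\<^sup>2 - (t - r)) \<partial>P) = (\<integral>\<omega>. G \<omega> * (D \<omega>)\<^sup>2 \<partial>P) - (t - r) * (\<integral>\<omega>. G \<omega> \<partial>P)"
      using that by (simp add: right_diff_distrib) (simp add: algebra_simps)
    then show ?thesis
      using integral_increment_square[OF r(1) assms(4) that(1,2)] by (simp add: D_def)
  qed
  have Z2: "integrable P (\<lambda>\<omega>. Z \<omega> * ((D \<omega>)\<^sup>2 - (t - r)))" "(\<integral>\<omega>. Z \<omega> * ((D \<omega>)\<^sup>2 - (t - r)) \<partial>P) = 0"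
    using integral_complex_mult_eq_0[OF ZP Zn iX sq0[OF _ Re_le bnd(1)] sq0[OF _ Im_le bnd(2)]]
    by auto
  have Dm [measurable]: "D \<in> borel_measurable P" using iD by simp
  have iR2: "integrable P (\<lambda>\<omega>. (u * D \<omega>)\<^sup>2 * min 1 \<bar>u * D \<omega>\<bar>)"
  proof (rule Bochner_Integration.integrable_bound)
    show "integrable P (\<lambda>\<omega>. u\<^sup>2 * (D \<omega>)\<^sup>2)" using iD2 by simp
    show "AE \<omega> in P. norm ((u * D \<omega>)\<^sup>2 * min 1 \<bar>u * D \<omega>\<bar>) \<le> norm (u\<^sup>2 * (D \<omega>)\<^sup>2)"
      by (intro AE_I2) (auto simp: abs_mult power_mult_distrib intro!: mult_right_le_one_le)
  qed measurable
  have ZRn: "norm (Z \<omega> * R (u * D \<omega>)) \<le> (u * D \<omega>)\<^sup>2 * min 1 \<bar>u * D \<omega>\<bar>" for \<omega>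
  proof -
    have "norm (Z \<omega> * R (u * D \<omega>)) \<le> 1 * norm (R (u * D \<omega>))"
      unfolding norm_mult by (intro mult_right_mono Zn) simp
    then show ?thesis using norm_iexp_taylor2[of "u * D \<omega>"] unfolding R_def by linarith
  qed
  have iZR: "integrable P (\<lambda>\<omega>. Z \<omega> * R (u * D \<omega>))"
  proof (rule Bochner_Integration.integrable_bound[OF iR2])
    show "(\<lambda>\<omega>. Z \<omega> * R (u * D \<omega>)) \<in> borel_measurable P"
      using ZP unfolding R_def by measurable
  qed (use ZRn in \<open>auto intro!: AE_I2 order_trans[OF ZRn]\<close>)
  \<comment> \<open>The quadratic Taylor term is centred at its mean \<open>t - r\<close>, the
    compensation going into the factor of the first summand; the last two summands then integrate to
    zero.\<close>
  have eq: "indicator A \<omega> * iexp (u * (N t \<omega> - N s \<omega>)) =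
      complex_of_real (1 - u\<^sup>2 * (t - r) / 2) * Z \<omega> + Z \<omega> * R (u * D \<omega>) + (\<i> * u) * (Z \<omega> * D \<omega>)
        - (u\<^sup>2 / 2) * (Z \<omega> * ((D \<omega>)\<^sup>2 - (t - r)))" (is "?lhs \<omega> = ?rhs \<omega>") for \<omega>
  proof -
    have "?lhs \<omega> = Z \<omega> * iexp (u * D \<omega>)"
      by (simp add: Z_def D_def exp_add[symmetric] algebra_simps)
    then show ?thesis
      by (simp add: R_def algebra_simps power2_eq_square) (simp add: field_simps)
  qed
  have "char_incr A u s t = (\<integral>\<omega>. ?rhs \<omega> \<partial>P)"
    unfolding char_incr_def by (simp only: eq)
  also have "\<dots> = complex_of_real (1 - u\<^sup>2 * (t - r) / 2) * (\<integral>\<omega>. Z \<omega> \<partial>P) + (\<integral>\<omega>. Z \<omega> * R (u * D \<omega>) \<partial>P)"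
    using iZ iZR Z1 Z2
    by (subst Bochner_Integration.integral_diff Bochner_Integration.integral_add;
        (intro Bochner_Integration.integrable_add integrable_mult_right)?; simp)+
  finally have "char_incr A u s t - complex_of_real (1 - u\<^sup>2 * (t - r) / 2) * char_incr A u s r = (\<integral>\<omega>. Z \<omega> * R (u * D \<omega>) \<partial>P)"
    by (simp add: char_incr_def Z_def)
  also have "norm \<dots> \<le> (\<integral>\<omega>. (u * D \<omega>)\<^sup>2 * min 1 \<bar>u * D \<omega>\<bar> \<partial>P)"
    by (rule order_trans[OF integral_norm_bound integral_mono]) (use iZR iR2 ZRn in auto)
  finally show ?thesis by (simp add: D_def)
qed

text \<open>The cap at 1 matches the minimum in the Taylor error and supplies the constant majorant
  for dominated convergence.\<close>

definition max_incr :: "real \<Rightarrow> real \<Rightarrow> nat \<Rightarrow> 'a \<Rightarrow> real" where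
  "max_incr s t n \<omega> = min 1 (Max ((\<lambda>i. \<bar>N (grid s t n (Suc i)) \<omega> - N (grid s t n i) \<omega>\<bar>) ` {..<Suc n}))"

lemma max_incr_bounds: "0 \<le> max_incr s t n \<omega>" "max_incr s t n \<omega> \<le> 1"
proof -
  have "0 \<le> Max ((\<lambda>i. \<bar>N (grid s t n (Suc i)) \<omega> - N (grid s t n i) \<omega>\<bar>) ` {..<Suc n})"
    by (subst Max_ge_iff) auto
  then show "0 \<le> max_incr s t n \<omega>" by (simp add: max_incr_def)
qed (simp add: max_incr_def)

lemma max_incr_ge:
  "i < Suc n \<Longrightarrow> min 1 \<bar>N (grid s t n (Suc i)) \<omega> - N (grid s t n i) \<omega>\<bar> \<le> max_incr s t n \<omega>"
  unfolding max_incr_def by (intro min.mono order_refl Max_ge) auto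

text \<open>A continuous path is uniformly continuous on \<open>[s, t]\<close>, which bounds all
  increments of a fine grid at once.\<close>

lemma max_incr_tendsto_0:
  assumes "0 \<le> s" "s < t" and cont: "continuous_on {0..} (\<lambda>r. N r \<omega>)"
  shows "(\<lambda>n. max_incr s t n \<omega>) \<longlonglongrightarrow> 0"
proof (rule LIMSEQ_I)
  fix e :: real assume e: "0 < e"
  have "uniformly_continuous_on {s..t} (\<lambda>r. N r \<omega>)"
    using assms by (intro compact_uniformly_continuous continuous_on_subset[OF cont]) auto
  then obtain d where d: "d > 0" "\<And>x y. x \<in> {s..t} \<Longrightarrow> y \<in> {s..t} \<Longrightarrow> dist y x < d \<Longrightarrow> dist (N y \<omega>) (N x \<omega>) < e"
    using e unfolding uniformly_continuous_on_def by metis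
  have "eventually (\<lambda>n. (t - s) / real (Suc n) < d) sequentially"
    using mesh_tendsto_0 d(1) by (rule order_tendstoD)
  then obtain n0 where n0: "\<And>n. n \<ge> n0 \<Longrightarrow> (t - s) / real (Suc n) < d"
    by (auto simp: eventually_sequentially)
  show "\<exists>n0. \<forall>n\<ge>n0. norm (max_incr s t n \<omega> - 0) < e"
  proof (intro exI allI impI)
    fix n assume n: "n0 \<le> n"
    have "\<bar>N (grid s t n (Suc i)) \<omega> - N (grid s t n i) \<omega>\<bar> < e" if "i < Suc n" for i
    proof -
      have "grid s t n k \<le> t" if "k \<le> Suc n" for k
      proof -
        have "(t - s) * real k \<le> (t - s) * real (Suc n)"
          using that assms by (intro mult_left_mono) auto
        then have "(t - s) * real k / real (Suc n) \<le> t - s"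
          by (simp add: pos_divide_le_eq del: of_nat_Suc)
        then show ?thesis by (simp add: grid_def)
      qed
      then have "grid s t n i \<in> {s..t}" "grid s t n (Suc i) \<in> {s..t}"
        using that assms by (auto simp: grid_ge)
      then have "dist (N (grid s t n (Suc i)) \<omega>) (N (grid s t n i) \<omega>) < e"
      proof (rule d(2))
        show "dist (grid s t n (Suc i)) (grid s t n i) < d"
          unfolding dist_real_def grid_step using n0[OF n] assms by (simp del: of_nat_Suc)
      qed
      then show ?thesis by (simp add: dist_real_def)
    qed
    then have "Max ((\<lambda>i. \<bar>N (grid s t n (Suc i)) \<omega> - N (grid s t n i) \<omega>\<bar>) ` {..<Suc n}) < e"
      by (subst Max_less_iff) auto
    then have "max_incr s t n \<omega> < e" by (simp add: max_incr_def)
    then show "norm (max_incr s t n \<omega> - 0) < e" using max_incr_bounds(1)[of s t n \<omega>] by simp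
  qed
qed

text \<open>The error is at most a constant times the integral of \<open>R n * S n\<close>, where
  \<open>R n\<close> tends to 0 almost surely and \<open>S n\<close> tends to \<open>t - s\<close>
  in \<open>L1\<close>. Replacing \<open>S n\<close> by \<open>t - s\<close> costs at most its
  \<open>L1\<close> distance since \<open>R n\<close> is at most 1; the rest vanishes by dominated
  convergence.\<close>

lemma char_incr_error_tendsto_0:
  assumes "0 \<le> s" "s < t"
  shows "(\<lambda>n. \<Sum>i<Suc n. \<integral>\<omega>. (u * (N (grid s t n (Suc i)) \<omega> - N (grid s t n i) \<omega>))\<^sup>2
            * min 1 \<bar>u * (N (grid s t n (Suc i)) \<omega> - N (grid s t n i) \<omega>)\<bar> \<partial>P) \<longlonglongrightarrow> 0"
proof -
  define D where "D n i \<omega> = N (grid s t n (Suc i)) \<omega> - N (grid s t n i) \<omega>" for n i \<omega>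
  define S where "S n \<omega> = (\<Sum>i<Suc n. (D n i \<omega>)\<^sup>2)" for n \<omega>
  define R where "R = max_incr s t"
  \<comment> \<open>The square contributes \<open>u\<^sup>2\<close>; the factor
    \<open>1 + \<bar>u\<bar>\<close> comes from pulling \<open>u\<close> out of the minimum in
    \<open>min_le\<close>.\<close>
  define c where "c = u\<^sup>2 * (1 + \<bar>u\<bar>)"
  have g0: "0 \<le> grid s t n i" for n i
    by (rule order_trans[OF assms(1) grid_ge]) (use assms in simp)
  have [measurable]: "D n i \<in> borel_measurable P" for n i
    unfolding D_def using measurable_N g0 by (intro borel_measurable_diff) auto
  have Rm [measurable]: "R n \<in> borel_measurable P" for n
    unfolding R_def max_incr_def D_def[symmetric] by measurable
  have iD: "integrable P (\<lambda>\<omega>. (D n i \<omega>)\<^sup>2)" for n i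
    unfolding D_def by (intro integrable_increment_square g0)
  have iS: "integrable P (S n)" for n
    unfolding S_def by (intro Bochner_Integration.integrable_sum iD)
  have R: "\<bar>R n \<omega>\<bar> \<le> 1" "0 \<le> R n \<omega>" for n \<omega>
    using max_incr_bounds[of s t n \<omega>] by (auto simp: R_def)
  have iR: "integrable P (R n)" for n
    by (rule integrable_const_bound[of _ 1]) (use R in auto)
  have iRS: "integrable P (\<lambda>\<omega>. R n \<omega> * S n \<omega>)" for n
    by (rule integrable_bounded_mult[OF iS Rm R(1)])
  have min_le: "min 1 \<bar>u * x\<bar> \<le> (1 + \<bar>u\<bar>) * min 1 \<bar>x\<bar>" for x
  proof (cases "\<bar>x\<bar> \<le> 1")
    case True
    then have "min 1 \<bar>u * x\<bar> \<le> \<bar>u\<bar> * \<bar>x\<bar>" by (simp add: abs_mult)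
    also have "\<dots> \<le> (1 + \<bar>u\<bar>) * \<bar>x\<bar>" by (intro mult_right_mono) auto
    finally show ?thesis using True by (simp add: min_def)
  next
    case False
    have "min 1 \<bar>u * x\<bar> \<le> 1" "1 \<le> 1 + \<bar>u\<bar>" by simp_all
    moreover have "min 1 \<bar>x\<bar> = 1" using False by simp
    ultimately show ?thesis by (simp only: mult_1_right)
  qed
  have bound: "(\<Sum>i<Suc n. (u * D n i \<omega>)\<^sup>2 * min 1 \<bar>u * D n i \<omega>\<bar>) \<le> c * (R n \<omega> * S n \<omega>)" for n \<omega>
  proof -
    have "(u * D n i \<omega>)\<^sup>2 * min 1 \<bar>u * D n i \<omega>\<bar> \<le> c * (R n \<omega> * (D n i \<omega>)\<^sup>2)" if "i < Suc n" for i
    proof -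
      have "min 1 \<bar>u * D n i \<omega>\<bar> \<le> (1 + \<bar>u\<bar>) * R n \<omega>"
        using max_incr_ge[OF that, of s t \<omega>] min_le[of "D n i \<omega>"]
        by (smt (verit) D_def R_def mult_left_mono abs_ge_zero)
      then have "(u * D n i \<omega>)\<^sup>2 * min 1 \<bar>u * D n i \<omega>\<bar> \<le> (u * D n i \<omega>)\<^sup>2 * ((1 + \<bar>u\<bar>) * R n \<omega>)"
        by (intro mult_left_mono) auto
      then show ?thesis by (simp add: c_def power_mult_distrib mult_ac)
    qed
    then have "(\<Sum>i<Suc n. (u * D n i \<omega>)\<^sup>2 * min 1 \<bar>u * D n i \<omega>\<bar>) \<le> (\<Sum>i<Suc n. c * (R n \<omega> * (D n i \<omega>)\<^sup>2))"
      by (intro sum_mono) auto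
    then show ?thesis by (simp only: S_def sum_distrib_left)
  qed
  have iE: "integrable P (\<lambda>\<omega>. (u * D n i \<omega>)\<^sup>2 * min 1 \<bar>u * D n i \<omega>\<bar>)" for n i
  proof (rule Bochner_Integration.integrable_bound)
    show "integrable P (\<lambda>\<omega>. u\<^sup>2 * (D n i \<omega>)\<^sup>2)" using iD by simp
    show "AE \<omega> in P. norm ((u * D n i \<omega>)\<^sup>2 * min 1 \<bar>u * D n i \<omega>\<bar>) \<le> norm (u\<^sup>2 * (D n i \<omega>)\<^sup>2)"
      by (intro AE_I2) (auto simp: abs_mult power_mult_distrib intro!: mult_right_le_one_le)
  qed measurable
  have limS: "(\<lambda>n. \<integral>\<omega>. \<bar>(t - s) - S n \<omega>\<bar> \<partial>P) \<longlonglongrightarrow> 0"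
    using qv_interval[OF assms] unfolding S_def D_def .
  have "AE \<omega> in P. (\<lambda>n. R n \<omega>) \<longlonglongrightarrow> 0"
    using cont by eventually_elim (unfold R_def, rule max_incr_tendsto_0[OF assms])
  then have limR: "(\<lambda>n. \<integral>\<omega>. R n \<omega> \<partial>P) \<longlonglongrightarrow> (\<integral>\<omega>. 0 \<partial>P)"
    by (intro integral_dominated_convergence[where w="\<lambda>_. 1"]) (use R in auto)
  have lim: "(\<lambda>n. c * ((t - s) * (\<integral>\<omega>. R n \<omega> \<partial>P) + (\<integral>\<omega>. \<bar>(t - s) - S n \<omega>\<bar> \<partial>P))) \<longlonglongrightarrow> 0"
    using tendsto_mult_left[OF tendsto_add[OF tendsto_mult_left[OF limR] limS], of c "t - s"] by simp
  have le: "(\<Sum>i<Suc n. \<integral>\<omega>. (u * D n i \<omega>)\<^sup>2 * min 1 \<bar>u * D n i \<omega>\<bar> \<partial>P)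
      \<le> c * ((t - s) * (\<integral>\<omega>. R n \<omega> \<partial>P) + (\<integral>\<omega>. \<bar>(t - s) - S n \<omega>\<bar> \<partial>P))" for n
  proof -
    have "(\<Sum>i<Suc n. \<integral>\<omega>. (u * D n i \<omega>)\<^sup>2 * min 1 \<bar>u * D n i \<omega>\<bar> \<partial>P)
        = (\<integral>\<omega>. (\<Sum>i<Suc n. (u * D n i \<omega>)\<^sup>2 * min 1 \<bar>u * D n i \<omega>\<bar>) \<partial>P)"
      by (rule Bochner_Integration.integral_sum[symmetric]) (rule iE)
    also have "\<dots> \<le> (\<integral>\<omega>. c * (R n \<omega> * S n \<omega>) \<partial>P)"
      by (intro integral_mono Bochner_Integration.integrable_sum iE integrable_mult_right iRS bound)
    also have "\<dots> = c * (\<integral>\<omega>. R n \<omega> * S n \<omega> \<partial>P)" by simp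
    also have "(\<integral>\<omega>. R n \<omega> * S n \<omega> \<partial>P) \<le> (\<integral>\<omega>. (t - s) * R n \<omega> + \<bar>(t - s) - S n \<omega>\<bar> \<partial>P)"
    proof (rule integral_mono)
      fix \<omega>
      have "R n \<omega> * (S n \<omega> - (t - s)) \<le> \<bar>R n \<omega>\<bar> * \<bar>(t - s) - S n \<omega>\<bar>"
        by (metis abs_ge_self abs_minus_commute abs_mult)
      also have "\<dots> \<le> 1 * \<bar>(t - s) - S n \<omega>\<bar>" by (intro mult_right_mono R) auto
      finally show "R n \<omega> * S n \<omega> \<le> (t - s) * R n \<omega> + \<bar>(t - s) - S n \<omega>\<bar>"
        by (simp add: algebra_simps)
    qed (use iRS iR iS in auto)
    also have "\<dots> = (t - s) * (\<integral>\<omega>. R n \<omega> \<partial>P) + (\<integral>\<omega>. \<bar>(t - s) - S n \<omega>\<bar> \<partial>P)"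
      using iR iS by simp
    finally show ?thesis by (simp add: c_def mult_left_mono)
  qed
  show ?thesis
    unfolding D_def[symmetric]
    by (rule tendsto_sandwich[OF _ _ tendsto_const lim])
      (intro always_eventually allI sum_nonneg Bochner_Integration.integral_nonneg, simp,
       intro always_eventually allI le)
qed

text \<open>Iterating \<open>char_incr_step\<close> over the grid multiplies the initial value
  \<open>prob A\<close> by the power of \<open>q n\<close> with exponent \<open>Suc n\<close>, the
  classical approximation of the exponential.\<close>

lemma char_incr_eq:
  assumes "0 \<le> s" "s < t" and A: "A \<in> sets (F s)"
  shows "char_incr A u s t = prob A * exp (- (u\<^sup>2 * (t - s) / 2))"
proof -
  define x where "x = - (u\<^sup>2 * (t - s) / 2)"
  define q where "q n = 1 + x / real (Suc n)" for n
  let ?a = "\<lambda>n i. char_incr A u s (grid s t n i)"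
  define E where "E n i = (\<integral>\<omega>. (u * (N (grid s t n (Suc i)) \<omega> - N (grid s t n i) \<omega>))\<^sup>2
            * min 1 \<bar>u * (N (grid s t n (Suc i)) \<omega> - N (grid s t n i) \<omega>)\<bar> \<partial>P)" for n i
  have "x \<le> 0" using assms by (simp add: x_def)
  have AP: "A \<in> events" using A subalgebra_F[OF assms(1)] by (auto simp: subalgebra_def)
  have a0: "char_incr A u s s = prob A"
  proof -
    have "char_incr A u s s = (\<integral>\<omega>. complex_of_real (indicator A \<omega>) \<partial>P)"
      unfolding char_incr_def by (intro Bochner_Integration.integral_cong) (auto simp: indicator_def)
    also have "\<dots> = complex_of_real (\<integral>\<omega>. indicator A \<omega> \<partial>P)"
      by (rule integral_complex_of_real)
    finally show ?thesis using AP by simp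
  qed
  have step: "norm (?a n (Suc i) - complex_of_real (q n) * ?a n i) \<le> E n i" for n i
  proof -
    have q: "complex_of_real (q n) = complex_of_real (1 - u\<^sup>2 * (grid s t n (Suc i) - grid s t n i) / 2)"
      unfolding grid_step q_def x_def by simp
    show ?thesis
      unfolding q E_def
      by (rule char_incr_step[OF A assms(1)]) (use assms(2) in \<open>simp_all add: grid_ge grid_less less_imp_le\<close>)
  qed
  have "eventually (\<lambda>n. norm (char_incr A u s t - complex_of_real (q n) ^ Suc n * prob A) \<le> (\<Sum>i<Suc n. E n i)) sequentially"
  proof -
    \<comment> \<open>\<open>iterate_error_bound\<close> requires \<open>q n\<close> to have modulus
      at most 1. As \<open>x \<le> 0\<close>, this holds once the grid is fine enough.\<close>
    have "eventually (\<lambda>n. - 1 < x / real (Suc n)) sequentially"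
      using mesh_tendsto_0[of x] by (rule order_tendstoD) simp
    then show ?thesis
    proof eventually_elim
      case (elim n)
      have "x / real (Suc n) \<le> 0" using \<open>x \<le> 0\<close> by (simp add: divide_nonpos_pos)
      then have "norm (complex_of_real (q n)) \<le> 1"
        using elim by (simp only: q_def norm_of_real)
      from iterate_error_bound[where m="Suc n" and a="?a n" and e="E n", OF this step] show ?case
        by (simp add: a0 del: power_Suc sum.lessThan_Suc)
    qed
  qed
  moreover have "(\<lambda>n. norm (char_incr A u s t - complex_of_real (q n) ^ Suc n * prob A))
      \<longlonglongrightarrow> norm (char_incr A u s t - exp x * prob A)"
  proof -
    have "(\<lambda>n. q n ^ Suc n) \<longlonglongrightarrow> exp x"
      using LIMSEQ_Suc[OF tendsto_exp_limit_sequentially[of x]] by (simp only: q_def)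
    then show ?thesis
      unfolding of_real_power[symmetric] of_real_mult[symmetric] by (intro tendsto_intros)
  qed
  moreover have "(\<lambda>n. \<Sum>i<Suc n. E n i) \<longlonglongrightarrow> 0"
    unfolding E_def by (rule char_incr_error_tendsto_0[OF assms(1,2)])
  ultimately have "norm (char_incr A u s t - exp x * prob A) \<le> 0"
    by (intro tendsto_le[OF trivial_limit_sequentially])
  then show ?thesis by (simp add: x_def mult.commute)
qed

section \<open>Law and independence of the increments\<close>

lemma increment_conditional_distr:
  assumes "0 \<le> s" "s < t" and A: "A \<in> sets (F s)" and pos: "prob A > 0"
  shows "distr (uniform_measure P A) borel (\<lambda>\<omega>. (N t \<omega> - N s \<omega>) / sqrt (t - s)) = std_normal_distribution"
proof (rule Levy_uniqueness)
  have AP: "A \<in> events" using A subalgebra_F[OF assms(1)] by (auto simp: subalgebra_def)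
  let ?U = "uniform_measure P A" and ?Y = "\<lambda>\<omega>. (N t \<omega> - N s \<omega>) / sqrt (t - s)"
  interpret U: prob_space ?U
    by (rule prob_space_uniform_measure) (use AP pos in \<open>auto simp: emeasure_eq_measure\<close>)
  have Y [measurable]: "?Y \<in> borel_measurable P"
    using measurable_N[of t] measurable_N[of s] assms by (intro borel_measurable_divide borel_measurable_diff) auto
  have YU: "?Y \<in> borel_measurable ?U" using Y by simp
  show "real_distribution (distr ?U borel ?Y)"
    unfolding real_distribution_def real_distribution_axioms_def
    using U.prob_space_distr[OF YU] by simp
  show "real_distribution std_normal_distribution" by (rule real_dist_normal_dist)
  show "char (distr ?U borel ?Y) = char std_normal_distribution"
  proof
    fix v
    \<comment> \<open>The standardisation of the increment is absorbed into the frequency.\<close>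
    define u where "u = v / sqrt (t - s)"
    have "1 / ennreal (prob A) = ennreal (1 / prob A)"
      using divide_ennreal[of 1 "prob A"] pos by simp
    then have U_eq: "?U = density P (\<lambda>\<omega>. ennreal (indicator A \<omega> / prob A))"
      unfolding uniform_measure_def using AP pos
      by (intro density_cong) (auto simp: emeasure_eq_measure divide_ennreal indicator_def ennreal_zero_divide)
    have "char (distr ?U borel ?Y) v = (\<integral>\<omega>. iexp (v * ?Y \<omega>) \<partial>?U)"
      unfolding char_def using YU by (subst integral_distr) auto
    also have "\<dots> = (\<integral>\<omega>. (indicator A \<omega> / prob A) *\<^sub>R iexp (v * ?Y \<omega>) \<partial>P)"
    proof -
      have "(\<lambda>\<omega>. iexp (v * ?Y \<omega>)) \<in> borel_measurable P" using Y by measurable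
      then show ?thesis
        unfolding U_eq by (rule integral_density) (use AP pos in auto)
    qed
    also have "\<dots> = (\<integral>\<omega>. (indicator A \<omega> * iexp (u * (N t \<omega> - N s \<omega>))) / prob A \<partial>P)"
      by (intro Bochner_Integration.integral_cong refl) (auto simp: indicator_def u_def scaleR_conv_of_real)
    also have "\<dots> = char_incr A u s t / prob A"
      by (simp add: char_incr_def)
    \<comment> \<open>Here \<open>prob A\<close> cancels, so the conditional law is the same for
      every such \<open>A\<close>.\<close>
    also have "\<dots> = exp (- (u\<^sup>2 * (t - s) / 2))"
      using pos by (simp add: char_incr_eq[OF assms(1-3)])
    also have "u\<^sup>2 * (t - s) = v\<^sup>2"
      using assms by (simp add: u_def power_divide)
    finally show "char (distr ?U borel ?Y) v = char std_normal_distribution v"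
      by (simp add: char_std_normal_distribution)
  qed
qed

text \<open>The second factor does not involve \<open>A\<close>, which is the form of independence
  exploited below. It arises from the conditional law after undoing the scaling; for a null event
  both sides vanish.\<close>

lemma increment_indep:
  assumes "0 \<le> s" "s < t" and A: "A \<in> sets (F s)" and B: "B \<in> sets borel"
  shows "prob (A \<inter> ((\<lambda>\<omega>. N t \<omega> - N s \<omega>) -` B \<inter> space P)) =
    prob A * measure std_normal_distribution ((\<lambda>x. sqrt (t - s) * x) -` B)"
proof (cases "prob A > 0")
  case True
  have AP: "A \<in> events" using A subalgebra_F[OF assms(1)] by (auto simp: subalgebra_def)
  let ?U = "uniform_measure P A" and ?Y = "\<lambda>\<omega>. (N t \<omega> - N s \<omega>) / sqrt (t - s)"
  let ?C = "(\<lambda>x. sqrt (t - s) * x) -` B"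
  have C: "?C \<in> sets borel"
    using B measurable_sets[of "\<lambda>x. sqrt (t - s) * x" borel borel B] by simp
  have Y [measurable]: "?Y \<in> borel_measurable P"
    using measurable_N[of t] measurable_N[of s] assms by (intro borel_measurable_divide borel_measurable_diff) auto
  have eq: "(\<lambda>\<omega>. N t \<omega> - N s \<omega>) -` B \<inter> space P = ?Y -` ?C \<inter> space P"
    using assms by auto
  have "measure std_normal_distribution ?C = measure (distr ?U borel ?Y) ?C"
    by (simp only: increment_conditional_distr[OF assms(1-3) True])
  also have "\<dots> = measure ?U (?Y -` ?C \<inter> space P)"
    using C Y by (subst measure_distr) auto
  also have "\<dots> = prob (A \<inter> (?Y -` ?C \<inter> space P)) / prob A"
    using True measurable_sets[OF Y C] by (intro measure_uniform_measure) (auto simp: emeasure_eq_measure)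
  finally show ?thesis using True by (simp add: eq)
next
  case False
  then have A0: "prob A = 0" using measure_nonneg[of P A] by linarith
  have AP: "A \<in> events" using A subalgebra_F[OF assms(1)] by (auto simp: subalgebra_def)
  have "prob (A \<inter> ((\<lambda>\<omega>. N t \<omega> - N s \<omega>) -` B \<inter> space P)) \<le> prob A"
    using AP by (intro finite_measure_mono) auto
  then show ?thesis using A0 measure_nonneg[of P] by (metis antisym mult_zero_left)
qed

text \<open>Conditioning on the whole space, which changes nothing, specialises the conditional law
  to the unconditional one.\<close>

lemma increment_distributed:
  assumes "0 \<le> s" "s < t"
  shows "distributed P lborel (\<lambda>\<omega>. N t \<omega> - N s \<omega>) (\<lambda>x. ennreal (normal_density 0 (sqrt (t - s)) x))"
proof -
  have sp: "space P \<in> sets (F s)"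
    using subalgebra_F[OF assms(1)] sets.top[of "F s"] by (simp add: subalgebra_def)
  let ?Y = "\<lambda>\<omega>. (N t \<omega> - N s \<omega>) / sqrt (t - s)"
  have Y: "?Y \<in> borel_measurable P"
    using measurable_N[of t] measurable_N[of s] assms by (intro borel_measurable_divide borel_measurable_diff) auto
  have U: "uniform_measure P (space P) = P"
    by (rule measure_eqI) (auto simp: emeasure_space_1 sets.Int_space_eq1 divide_ennreal_def)
  have "distr P lborel ?Y = distr P borel ?Y" by (rule distr_cong) auto
  also have "\<dots> = std_normal_distribution"
    using increment_conditional_distr[OF assms sp] by (simp add: U prob_space)
  finally have "distributed P lborel ?Y (\<lambda>x. ennreal (std_normal_density x))"
    using Y by (simp add: distributed_def)
  then show ?thesis
    using normal_standard_normal_convert[of "sqrt (t - s)" "\<lambda>\<omega>. N t \<omega> - N s \<omega>" 0] assms by simp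
qed

text \<open>Comparing \<open>increment_indep\<close> for \<open>A\<close> and for the whole space
  identifies the common factor.\<close>

lemma prob_Int_increment:
  assumes "0 \<le> s" "s \<le> t" and A: "A \<in> sets (F s)" and B: "B \<in> sets borel"
  shows "prob (A \<inter> ((\<lambda>\<omega>. N t \<omega> - N s \<omega>) -` B \<inter> space P)) =
    prob A * prob ((\<lambda>\<omega>. N t \<omega> - N s \<omega>) -` B \<inter> space P)"
proof (cases "s = t")
  \<comment> \<open>Sorted time lists may repeat a point. The increment is then zero, so its event
    is empty or the whole space.\<close>
  case True
  have "A \<in> events" using A subalgebra_F[OF assms(1)] by (auto simp: subalgebra_def)
  then show ?thesis
    using True by (cases "0 \<in> B") (auto simp: prob_space)
next
  case False
  then have st: "s < t" using assms by simp
  have sp: "space P \<in> sets (F s)"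
    using subalgebra_F[OF assms(1)] sets.top[of "F s"] by (simp add: subalgebra_def)
  show ?thesis
    using increment_indep[OF assms(1) st A B] increment_indep[OF assms(1) st sp B]
    by (simp add: prob_space Int_absorb1)
qed

text \<open>All earlier increments are measurable at the time where the latest one starts, so
  \<open>prob_Int_increment\<close> splits off one factor at a time.\<close>

lemma increments_indep:
  assumes ts: "sorted ts" "\<forall>t\<in>set ts. 0 \<le> t"
  shows "indep_vars (\<lambda>_. borel) (\<lambda>i \<omega>. N (ts ! Suc i) \<omega> - N (ts ! i) \<omega>) {..<length ts - 1}"
\<comment> \<open>The truncated difference is 0 for lists with at most one point; there are no
  increments in that case.\<close>
proof (cases "length ts - 1 = 0")
  case True
  then show ?thesis by (simp add: indep_vars_def2 indep_sets_def)
next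
  case False
  let ?n = "length ts - 1"
  define D where "D i \<omega> = N (ts ! Suc i) \<omega> - N (ts ! i) \<omega>" for i \<omega>
  have nn: "0 \<le> ts ! i" if "i \<le> ?n" for i
    using that ts(2) False by auto
  have mono: "ts ! i \<le> ts ! k" if "i \<le> k" "k \<le> ?n" for i k
    using ts(1) that False by (intro sorted_nth_mono) auto
  have DF: "D i \<in> borel_measurable (F (ts ! k))" if "i < k" "k \<le> ?n" for i k
    unfolding D_def using that
    by (intro borel_measurable_diff measurable_F_mono[OF nn mono adapted[OF nn]]) auto
  have DP: "D i \<in> borel_measurable P" if "i < ?n" for i
    using measurable_F[OF nn[of ?n] DF[OF that]] by simp
  \<comment> \<open>Intersecting with \<open>space P\<close> gives the empty intersection, which is
    \<open>UNIV\<close>, the probability 1 of the empty product.\<close>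
  have product: "prob (space P \<inter> (\<Inter>i<m. D i -` B i \<inter> space P)) = (\<Prod>i<m. prob (D i -` B i \<inter> space P))"
    if "m \<le> ?n" "\<And>i. i < m \<Longrightarrow> B i \<in> sets borel" for m and B :: "nat \<Rightarrow> real set"
    using that
  proof (induction m)
    case 0
    then show ?case by (simp add: prob_space)
  next
    case (Suc m)
    let ?A = "space P \<inter> (\<Inter>i<m. D i -` B i \<inter> space P)"
    have m: "0 \<le> ts ! m" "ts ! m \<le> ts ! Suc m" using Suc.prems nn mono by auto
    have spF: "space (F (ts ! m)) = space P"
      using subalgebra_F[OF m(1)] by (simp add: subalgebra_def)
    have "D i -` B i \<inter> space P \<in> sets (F (ts ! m))" if "i < m" for i
      using measurable_sets[OF DF[OF that] Suc.prems(2)[of i]] Suc.prems(1) that by (simp add: spF)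
    then have "(\<Inter>i<m. D i -` B i \<inter> space P) \<in> sets (F (ts ! m))" if "m \<noteq> 0"
      using that by (intro sets.finite_INT) auto
    then have A: "?A \<in> sets (F (ts ! m))"
      using sets.top[of "F (ts ! m)"] unfolding spF by (cases "m = 0") (simp, blast intro: sets.Int)
    have "space P \<inter> (\<Inter>i<Suc m. D i -` B i \<inter> space P) = ?A \<inter> (D m -` B m \<inter> space P)"
      by (auto simp: lessThan_Suc)
    then have "prob (space P \<inter> (\<Inter>i<Suc m. D i -` B i \<inter> space P)) = prob ?A * prob (D m -` B m \<inter> space P)"
      using prob_Int_increment[OF m A Suc.prems(2)[of m]] unfolding D_def by simp
    then show ?case using Suc by simp
  qed
  \<comment> \<open>Each family contains \<open>space P\<close>, so the product rule over the full
    index set covers all its subsets.\<close>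
  have "indep_sets (\<lambda>i. {D i -` B \<inter> space P |B. B \<in> sets borel}) {..<?n}"
  proof (subst indep_sets_finite)
    show "{..<?n} \<noteq> {}" using False by (simp add: lessThan_empty_iff)
    show "{D i -` B \<inter> space P |B. B \<in> sets borel} \<subseteq> events" if "i \<in> {..<?n}" for i
      using measurable_sets[OF DP] that by auto
    show "space P \<in> {D i -` B \<inter> space P |B. B \<in> sets borel}" for i
      by (auto intro!: exI[of _ UNIV])
    show "\<forall>A\<in>Pi {..<?n} (\<lambda>i. {D i -` B \<inter> space P |B. B \<in> sets borel}).
        prob (\<Inter>j\<in>{..<?n}. A j) = (\<Prod>j\<in>{..<?n}. prob (A j))"
    proof
      fix A assume "A \<in> Pi {..<?n} (\<lambda>i. {D i -` B \<inter> space P |B. B \<in> sets borel})"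
      then have "\<forall>i\<in>{..<?n}. \<exists>B. A i = D i -` B \<inter> space P \<and> B \<in> sets borel" by (auto simp: Pi_iff)
      then obtain B where B: "\<And>i. i < ?n \<Longrightarrow> A i = D i -` B i \<inter> space P" "\<And>i. i < ?n \<Longrightarrow> B i \<in> sets borel"
        by (metis lessThan_iff)
      have "(\<Inter>j\<in>{..<?n}. A j) = space P \<inter> (\<Inter>i<?n. D i -` B i \<inter> space P)"
        using B(1) False by (auto simp: lessThan_empty_iff)
      then have "prob (\<Inter>j\<in>{..<?n}. A j) = prob (space P \<inter> (\<Inter>i<?n. D i -` B i \<inter> space P))"
        by (rule arg_cong)
      also have "\<dots> = (\<Prod>i<?n. prob (D i -` B i \<inter> space P))"
        by (rule product[OF order_refl B(2)])
      also have "\<dots> = (\<Prod>j\<in>{..<?n}. prob (A j))"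
        by (rule prod.cong) (auto simp: B(1))
      finally show "prob (\<Inter>j\<in>{..<?n}. A j) = (\<Prod>j\<in>{..<?n}. prob (A j))" .
    qed
  qed simp
  then show ?thesis
    using DP unfolding indep_vars_def2 D_def by auto
qed

lemma standard_brownian_motion_N: "standard_brownian_motion P N"
  unfolding standard_brownian_motion_def
  using measurable_N start cont increments_indep increment_distributed by auto

end

section \<open>Evaluations of set-valued martingales\<close>

text \<open>Only one inequality is claimed, because \<open>g\<close> may fail to be measurable and
  then has infinite \<open>L2_norm\<close>.\<close>

lemma L2_norm_le_of_AE_eq:
  assumes "g' \<in> borel_measurable P" "AE \<omega> in P. g \<omega> = g' \<omega>"
  shows "L2_norm P g' \<le> L2_norm P g"
proof (cases "g \<in> borel_measurable P \<and> integrable P (\<lambda>\<omega>. (g \<omega>)\<^sup>2)")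
  case True
  have ae: "AE \<omega> in P. (g \<omega>)\<^sup>2 = (g' \<omega>)\<^sup>2" using assms(2) by eventually_elim simp
  have "integrable P (\<lambda>\<omega>. (g' \<omega>)\<^sup>2)"
    using True assms(1) ae integrable_cong_AE[of "\<lambda>\<omega>. (g \<omega>)\<^sup>2" P "\<lambda>\<omega>. (g' \<omega>)\<^sup>2"] by auto
  moreover have "(\<integral>\<omega>. (g \<omega>)\<^sup>2 \<partial>P) = (\<integral>\<omega>. (g' \<omega>)\<^sup>2 \<partial>P)"
    using True assms(1) ae by (intro integral_cong_AE) auto
  ultimately show ?thesis using True assms(1) by (simp add: L2_norm_def)
qed (auto simp: L2_norm_def)

lemma partitions_nonneg:
  assumes "ts \<in> partitions T" "i < length ts"
  shows "0 \<le> ts ! i"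
proof -
  have ts: "sorted_wrt (<) ts" "ts ! 0 = 0"
    using assms by (auto simp: partitions_def hd_conv_nth)
  show ?thesis
  proof (cases "i = 0")
    case False
    then have "ts ! 0 < ts ! i" using sorted_wrt_nth_less[OF ts(1), of 0 i] assms(2) by simp
    then show ?thesis using ts(2) by simp
  qed (simp add: ts)
qed

lemma apply_sum_of_squares:
  "apply_bcontfun (sum_of_squares M ts \<omega>) k =
    (\<Sum>i<length ts - 1. (apply_bcontfun (M (ts ! Suc i) \<omega>) k - apply_bcontfun (M (ts ! i) \<omega>) k)\<^sup>2)"
  unfolding sum_of_squares_def
  by (simp add: power2_eq_square linear_sum[OF bounded_linear.linear[OF bounded_linear_apply_bcontfun[of k]]])

text \<open>Evaluation at \<open>k\<close> is bounded, linear and multiplicative, so it commutes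
  with conditional expectations, preserves weak continuity and maps the sums of squares to real
  ones.\<close>

lemma evaluation_levy_martingale:
  fixes M Q :: "real \<Rightarrow> 'a \<Rightarrow> ('k::t2_space \<Rightarrow>\<^sub>C real)"
  assumes P: "prob_space P" and filt: "filtration_on P F"
    and mart: "bochner_martingale P F M"
    and start: "AE \<omega> in P. M 0 \<omega> = 0"
    and cont: "weakly_continuous_paths P M"
    and qv: "quadratic_variation P M Q"
    and Q: "\<And>T. T \<ge> 0 \<Longrightarrow> AE \<omega> in P. Q T \<omega> = T *\<^sub>R CK_unit"
  shows "levy_martingale P F (\<lambda>t \<omega>. apply_bcontfun (M t \<omega>) k)"
proof -
  interpret prob_space P by (rule P)
  have bl: "bounded_linear (\<lambda>x :: 'k \<Rightarrow>\<^sub>C real. apply_bcontfun x k)"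
    by (rule bounded_linear_apply_bcontfun)
  have sub: "subalgebra P (F t)" if "t \<ge> 0" for t
    using filt that by (simp add: filtration_on_def)
  have bi: "bochner_integrable P (M t)" if "t \<ge> 0" for t
    using mart that by (simp add: bochner_martingale_def)
  have ce: "bochner_cond_exp P (F s) (M t) (M s)" if "0 \<le> s" "s < t" for s t
    using mart that by (simp add: bochner_martingale_def)
  have meas: "(\<lambda>\<omega>. apply_bcontfun (M t \<omega>) k) \<in> borel_measurable P" if "t \<ge> 0" for t
    using bi[OF that] by (intro borel_measurable_apply_bcontfun) (simp add: bochner_integrable_def)
  show ?thesis
  proof
    show "filtration_on P F" by (rule filt)
    show "(\<lambda>\<omega>. apply_bcontfun (M t \<omega>) k) \<in> borel_measurable (F t)" if "t \<ge> 0" for t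
    proof -
      \<comment> \<open>Adaptedness is contained in the martingale property: \<open>M t\<close> is a
        version of the conditional expectation of a later value, for which \<open>t + 1\<close> is
        an arbitrary choice.\<close>
      have "M t \<in> borel_measurable (restr_to_subalg P (F t))"
        using ce[OF that, of "t + 1"] by (simp add: bochner_cond_exp_def bochner_integrable_def)
      from borel_measurable_apply_bcontfun[OF measurable_in_subalg'[OF sub[OF that] this]]
      show ?thesis .
    qed
    show "integrable P (\<lambda>\<omega>. apply_bcontfun (M t \<omega>) k)" if "t \<ge> 0" for t
      by (rule Bochner_Integration.integrable_bound[OF bochner_integrable_norm_integrable[OF bi[OF that]] meas[OF that]])
        (simp add: norm_bounded[where 'b=real, simplified])
    show "AE \<omega> in P. real_cond_exp P (F s) (\<lambda>\<omega>. apply_bcontfun (M t \<omega>) k) \<omega> = apply_bcontfun (M s \<omega>) k"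
      if "0 \<le> s" "s < t" for s t
      using ce[OF that] bl unfolding bochner_cond_exp_def by blast
    show "AE \<omega> in P. apply_bcontfun (M 0 \<omega>) k = 0"
      using start by eventually_elim simp
    show "AE \<omega> in P. continuous_on {0..} (\<lambda>r. apply_bcontfun (M r \<omega>) k)"
      using cont[unfolded weakly_continuous_paths_def] by eventually_elim (use bl in blast)
    fix T :: real assume T: "T > 0"
    let ?S = "\<lambda>ts \<omega>. \<Sum>i<length ts - 1.
      (apply_bcontfun (M (ts ! Suc i) \<omega>) k - apply_bcontfun (M (ts ! i) \<omega>) k)\<^sup>2"
    have "evaluation_functional (\<lambda>x :: 'k \<Rightarrow>\<^sub>C real. apply_bcontfun x k)"
      by (auto simp: evaluation_functional_def)
    then have lim: "((\<lambda>ts. L2_norm P (\<lambda>\<omega>. apply_bcontfun (Q T \<omega>) k - ?S ts \<omega>)) \<longlongrightarrow> 0) (mesh_to_0 T)"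
      using qv T unfolding quadratic_variation_def apply_sum_of_squares[symmetric] by blast
    have "eventually (\<lambda>ts. ts \<in> partitions T) (mesh_to_0 T)"
      by (simp add: mesh_to_0_def eventually_inf_principal)
    \<comment> \<open>\<open>Q T\<close> is known only up to a null set that may vary with
      \<open>T\<close>, so the constant is substituted under the norm and the limit recovered by
      squeezing.\<close>
    then have "eventually (\<lambda>ts. L2_norm P (\<lambda>\<omega>. T - ?S ts \<omega>) \<le>
        L2_norm P (\<lambda>\<omega>. apply_bcontfun (Q T \<omega>) k - ?S ts \<omega>)) (mesh_to_0 T)"
    proof eventually_elim
      case (elim ts)
      show ?case
      proof (rule L2_norm_le_of_AE_eq)
        show "(\<lambda>\<omega>. T - ?S ts \<omega>) \<in> borel_measurable P"
          by (intro borel_measurable_diff borel_measurable_sum borel_measurable_power measurable_const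
              meas partitions_nonneg[OF elim]) auto
        show "AE \<omega> in P. apply_bcontfun (Q T \<omega>) k - ?S ts \<omega> = T - ?S ts \<omega>"
          using Q[of T] T by (auto simp: CK_unit_def const_bcontfun.rep_eq)
      qed
    qed
    then show "((\<lambda>ts. L2_norm P (\<lambda>\<omega>. T - ?S ts \<omega>)) \<longlongrightarrow> 0) (mesh_to_0 T)"
      by (intro tendsto_sandwich[OF _ _ tendsto_const lim]) auto
  qed
qed

theorem theorem3p12:
  fixes j :: "'x::banach set \<Rightarrow> ('k::t2_space \<Rightarrow>\<^sub>C real)"
    and P :: "'a measure"
    and F :: "real \<Rightarrow> 'a measure"
    and L :: "('k \<Rightarrow>\<^sub>C real) set"
    and M Q :: "real \<Rightarrow> 'a \<Rightarrow> ('k \<Rightarrow>\<^sub>C real)"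
  assumes "compact (UNIV :: 'k set)"
    and "ck_embedding j"
    and "prob_space P"
    and "filtration_on P F"
    and "f_algebra L"
    and "\<And>t \<omega>. t \<ge> 0 \<Longrightarrow> \<omega> \<in> space P \<Longrightarrow> M t \<omega> \<in> ck_r j"
    and "\<And>t \<omega>. t \<ge> 0 \<Longrightarrow> \<omega> \<in> space P \<Longrightarrow> M t \<omega> \<in> L"
    and "bochner_martingale P F M"
    and "AE \<omega> in P. M 0 \<omega> = 0"
    and "weakly_continuous_paths P M"
    and "quadratic_variation P M Q"
    and "\<And>T. T \<ge> 0 \<Longrightarrow> AE \<omega> in P. Q T \<omega> = T *\<^sub>R CK_unit"
  shows "set_valued_brownian_motion j P M"
proof -
  interpret prob_space P by (rule assms(3))
  have levy: "levy_martingale P F (\<lambda>t \<omega>. apply_bcontfun (M t \<omega>) k)" for k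
    by (rule evaluation_levy_martingale[OF assms(3,4,8-12)])
  have bi: "bochner_integrable P (M t)" if "t \<ge> 0" for t
    using assms(8) that by (simp add: bochner_martingale_def)
  \<comment> \<open>At a point annihilating \<open>j\<close> the evaluation of \<open>M\<close>
    would vanish identically, whereas its increment from time 0 to time 1 has second moment
    1.\<close>
  have nonzero: "\<exists>A\<in>ck. apply_bcontfun (j A) k \<noteq> 0" for k
  proof (rule ccontr)
    assume "\<not> ?thesis"
    then have zero: "apply_bcontfun (M t \<omega>) k = 0" if "t \<ge> 0" "\<omega> \<in> space P" for t \<omega>
      using assms(6)[OF that] by (auto simp: ck_r_def)
    have "(\<integral>\<omega>. 1 * (apply_bcontfun (M 1 \<omega>) k - apply_bcontfun (M 0 \<omega>) k)\<^sup>2 \<partial>P) = (1 - 0) * (\<integral>\<omega>. 1 \<partial>P)"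
      by (rule levy_martingale.integral_increment_square[OF levy, where B=1]) auto
    moreover have "(\<integral>\<omega>. 1 * (apply_bcontfun (M 1 \<omega>) k - apply_bcontfun (M 0 \<omega>) k)\<^sup>2 \<partial>P) = (\<integral>\<omega>. 0 \<partial>P)"
      by (rule Bochner_Integration.integral_cong) (simp_all add: zero)
    ultimately show False by (simp add: prob_space)
  qed
  obtain S c where S: "finite S" "\<And>A. A \<in> ck \<Longrightarrow> norm (j A) \<le> c * (\<Sum>k\<in>S. \<bar>apply_bcontfun (j A) k\<bar>)"
    using embedding_norm_bound[OF assms(2,1) nonzero] by blast
  \<comment> \<open>Both sides scale by the absolute value of \<open>r\<close>, so negative
    multiples in \<open>ck_r j\<close> are covered too.\<close>
  have bound: "norm (M t \<omega>) \<le> c * (\<Sum>k\<in>S. \<bar>apply_bcontfun (M t \<omega>) k\<bar>)"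
    if t: "t \<ge> 0" and \<omega>: "\<omega> \<in> space P" for t \<omega>
  proof -
    obtain r B where B: "M t \<omega> = r *\<^sub>R j B" "B \<in> ck" using assms(6)[OF t \<omega>] by (auto simp: ck_r_def)
    have "\<bar>r\<bar> * norm (j B) \<le> \<bar>r\<bar> * (c * (\<Sum>k\<in>S. \<bar>apply_bcontfun (j B) k\<bar>))"
      by (intro mult_left_mono S B) simp
    then show ?thesis by (simp add: B abs_mult sum_distrib_left mult_ac)
  qed
  \<comment> \<open>Cauchy-Schwarz over the finite set \<open>S\<close> reduces the norm to second
    moments of finitely many real martingales.\<close>
  have square: "integrable P (\<lambda>\<omega>. (norm (M t \<omega>))\<^sup>2)" if t: "t \<ge> 0" for t
  proof (rule Bochner_Integration.integrable_bound)
    show "integrable P (\<lambda>\<omega>. c\<^sup>2 * ((\<Sum>k\<in>S. (apply_bcontfun (M t \<omega>) k)\<^sup>2) * card S))"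
      by (intro integrable_mult_right integrable_mult_left Bochner_Integration.integrable_sum
          levy_martingale.square_integrable_N[OF levy] t)
    show "(\<lambda>\<omega>. (norm (M t \<omega>))\<^sup>2) \<in> borel_measurable P"
      using bochner_integrable_norm_integrable[OF bi[OF t]] by auto
    show "AE \<omega> in P. norm ((norm (M t \<omega>))\<^sup>2) \<le> norm (c\<^sup>2 * ((\<Sum>k\<in>S. (apply_bcontfun (M t \<omega>) k)\<^sup>2) * card S))"
    proof (rule AE_I2)
      fix \<omega> assume \<omega>: "\<omega> \<in> space P"
      have "(norm (M t \<omega>))\<^sup>2 \<le> (c * (\<Sum>k\<in>S. \<bar>apply_bcontfun (M t \<omega>) k\<bar>))\<^sup>2"
        by (intro power_mono bound t \<omega>) simp
      also have "\<dots> = c\<^sup>2 * (\<Sum>k\<in>S. \<bar>apply_bcontfun (M t \<omega>) k\<bar>)\<^sup>2" by (rule power_mult_distrib)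
      also have "\<dots> \<le> c\<^sup>2 * ((\<Sum>k\<in>S. \<bar>apply_bcontfun (M t \<omega>) k\<bar>\<^sup>2) * card S)"
        by (intro mult_left_mono sum_squared_le_sum_of_squares) simp
      finally show "norm ((norm (M t \<omega>))\<^sup>2) \<le> norm (c\<^sup>2 * ((\<Sum>k\<in>S. (apply_bcontfun (M t \<omega>) k)\<^sup>2) * card S))"
        by simp
    qed
  qed
  show ?thesis
    unfolding set_valued_brownian_motion_def evaluation_functional_def
    using assms(5-7) bi bochner_integrable_CK_square[OF bi square]
      levy_martingale.standard_brownian_motion_N[OF levy]
    by (auto intro!: exI[of _ L])
qed

end
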